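(* Let $K$ be a number field, let $d\ge 2$ be an integer, and let $a,c,\alpha\in K$ with $a\neq 0$. Suppose that $0$ is periodic under $f:=ax^d+c$. Then $G_\infty(f,\alpha)$ is abelian if and only if $c=0$ and $(f,\alpha)$ is $K^{\mathrm{ab}}$-conjugate to $(x^d,\gamma)$, where $\gamma$ is either $0$ or a root of unity. In particular, if $a=1$ and $G_\infty(f,\alpha)$ is abelian, then $c=0$ and $\alpha$ is either $0$ or a root of unity.
   Context: For a number field $K$ with fixed algebraic closure $\overline{K}$, a polynomial $f\in K[x]$ and $\alpha\in K$, let $f^n$ be the $n$-th iterate of $f$, $T_\infty(f,\alpha)=\bigcup_{n\ge 0}f^{-n}(\alpha)\subseteq\overline{K}$, $K_\infty(f,\alpha)=K(T_\infty(f,\alpha))$, and $G_\infty(f,\alpha)=\mathrm{Gal}(K_\infty(f,\alpha)/K)$ (the dynamical Galois group). $0$ is periodic under $f$ if $f^n(0)=0$ for some $n\ge 1$. $K^{\mathrm{ab}}$ is the maximal abelian extension of $K$ in $\overline{K}$. Two pairs $(f,\alpha)$ and $(g,\beta)$ are $K^{\mathrm{ab}}$-conjugate if there is an affine map $m(x)=ux+v$ with $u,v\in K^{\mathrm{ab}}$, $u\ne 0$, such that $m^{-1}\circ f\circ m=g$ and $m^{-1}(\alpha)=\beta$.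
   Formalization: When α = 0 the criterion is just c = 0, without requiring K^ab-conjugacy to (x^d, γ); as printed the equivalence fails, e.g. for K = ℚ, f = 2x^4, α = 0, where G_∞ is trivial but conjugacy needs a cube root of 1/2 in ℚ^ab. *)

theory Defs
  imports
    "HOL-Algebra.Algebra"
    "HOL-Algebra.Algebraic_Closure_Type"
    "HOL-Computational_Algebra.Computational_Algebra"
begin

text \<open>
  All fields are subfields of a fixed field type, viewed as a HOL-Algebra ring so that
  \<^const>\<open>subfield\<close>, \<^const>\<open>generate_field\<close> and \<^const>\<open>algebraic_closure\<close> apply. The theorem assumes
  that the whole type is an algebraic closure of the number field \<open>K\<close>.
\<close>

abbreviation ambient :: "'a::field ring"
  where "ambient \<equiv> ring_of_type_algebra"

definition number_field :: "'a::field_char_0 set \<Rightarrow> bool"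
  where "number_field K \<longleftrightarrow> subfield K ambient \<and> ring.finite_dimension ambient \<rat> K"

text \<open>
  As in \<^const>\<open>BijGroup\<close>, automorphisms of \<open>L\<close> are extensional (undefined outside \<open>L\<close>), so that
  distinct elements of the carrier are distinct maps on \<open>L\<close>.
\<close>

definition Gal :: "'a::field set \<Rightarrow> 'a set \<Rightarrow> ('a \<Rightarrow> 'a) monoid"
  where "Gal L K = (BijGroup L)
    \<lparr>carrier := {\<sigma> \<in> Bij L. \<sigma> \<in> ring_hom (ambient\<lparr>carrier := L\<rparr>) (ambient\<lparr>carrier := L\<rparr>)
                          \<and> (\<forall>x\<in>K. \<sigma> x = x)}\<rparr>"

definition galois_extension :: "'a::field set \<Rightarrow> 'a set \<Rightarrow> bool"
  where "galois_extension K L \<longleftrightarrow>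
    subfield K ambient \<and> subfield L ambient \<and> K \<subseteq> L \<and>
    (\<forall>x\<in>L. (ring.algebraic ambient over K) x) \<and>
    {x \<in> L. \<forall>\<sigma>\<in>carrier (Gal L K). \<sigma> x = x} = K"

definition abelian_extension :: "'a::field set \<Rightarrow> 'a set \<Rightarrow> bool"
  where "abelian_extension K L \<longleftrightarrow> galois_extension K L \<and> comm_group (Gal L K)"

text \<open>The compositum of all (finite or infinite) abelian extensions inside the ambient field.\<close>

definition max_abelian_extension :: "'a::field set \<Rightarrow> 'a set"
  where "max_abelian_extension K = generate_field ambient (\<Union>{L. abelian_extension K L})"

definition preimage_tree :: "'a::field poly \<Rightarrow> 'a \<Rightarrow> 'a set"
  where "preimage_tree f \<alpha> = (\<Union>n. (poly f ^^ n) -` {\<alpha>})"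

definition K_infty :: "'a::field set \<Rightarrow> 'a poly \<Rightarrow> 'a \<Rightarrow> 'a set"
  where "K_infty K f \<alpha> = generate_field ambient (K \<union> preimage_tree f \<alpha>)"

definition G_infty :: "'a::field set \<Rightarrow> 'a poly \<Rightarrow> 'a \<Rightarrow> ('a \<Rightarrow> 'a) monoid"
  where "G_infty K f \<alpha> = Gal (K_infty K f \<alpha>) K"

definition periodic_point :: "'a::field poly \<Rightarrow> 'a \<Rightarrow> bool"
  where "periodic_point f x \<longleftrightarrow> (\<exists>n\<ge>1. (poly f ^^ n) x = x)"

text \<open>Here \<open>m = u x + v\<close>, with inverse \<open>(x - v) / u\<close>.\<close>

definition conjugate_over ::
    "'a::field set \<Rightarrow> 'a poly \<times> 'a \<Rightarrow> 'a poly \<times> 'a \<Rightarrow> bool"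
  where "conjugate_over E = (\<lambda>(f, \<alpha>) (g, \<beta>).
    \<exists>u\<in>E. \<exists>v\<in>E. u \<noteq> 0 \<and>
      (let m = [:v, u:]; m_inv = [:- v / u, 1 / u:]
       in pcompose m_inv (pcompose f m) = g \<and> poly m_inv \<alpha> = \<beta>))"

definition root_of_unity :: "'a::field \<Rightarrow> bool"
  where "root_of_unity z \<longleftrightarrow> (\<exists>n\<ge>1. z ^ n = 1)"

text \<open>
  Pitfall: for \<open>c = 0\<close> and \<open>\<alpha> = 0\<close> the tree is \<open>{0}\<close>, so the dynamical Galois group is trivial, but
  \<open>a x^d\<close> is conjugate to \<open>x^d\<close> over the maximal abelian extension only if the latter contains a
  \<open>(d - 1)\<close>-st root of \<open>a\<close>, which fails e.g. for \<open>2 x^4\<close> over the rationals. The criterion must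
  therefore admit \<open>\<alpha> = 0\<close> (with \<open>c = 0\<close>) without asking for the conjugacy; for \<open>\<alpha> \<noteq> 0\<close> it is
  the conjugacy to \<open>(x^d, \<gamma>)\<close>.
\<close>

end

(*
  Over K let u^(d-1) = a; the scaling x -> u x turns f into g(x) = x^d + u c. If 0 has period m + 1
  under g, then evaluating g^m(x) - beta at g(0) expresses every point beta of the backward tree, up to
  sign, as a d-th power of a product of points of the tree. So the points of the tree are infinitely
  d-divisible up to sign in K_infty. If K_infty / K is abelian, a Kummer argument followed by Northcott's
  theorem shows that an infinitely divisible number is 0 or a root of unity. Hence almost all points gamma
  of the tree are roots of unity, and so are the gamma - u c, which are d-th powers of points of the tree.
  For c nonzero this leaves only finitely many gamma, whereas the tree is infinite. For c = 0 it says that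
  u alpha is 0 or a root of unity, and conversely the tree is then alpha times a set of roots of unity,
  on which all automorphisms commute.
*)

theory Submission
  imports Defs
begin

text \<open>Abelianness is used only in the form that automorphisms of the ambient field commute at
  a given element, so it survives enlarging the base. A tree point lies in K_infty rather than in K,
  and the divisibility argument runs over a finite set of generators with that point adjoined.
  Kummer step: let N = p^k and y^N = b with b in the base, and let \<tau> act on the N-th roots of
  unity as the t-th power. Commutation puts \<open>\<tau> y / y ^ t\<close> in the base, so b^(t-1)
  is an N-th power there, which says nothing if N divides t-1. Hence \<tau> is chosen, once for all
  k, to move a root of unity of order p^w, where w kills every root of unity of the base. Then
  gcd(t-1, N) divides p^(w-1), only a bounded power of b is lost, and b^w is an n-th power in the
  base for unbounded n. Such roots have a common denominator and bounded conjugates, so Northcott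
  applies. One prime p dividing d suffices, and signs vanish on squaring. The scalar u need not lie
  in K and is adjoined to the base; for c = 0 and \<alpha> nonzero it lies in K^ab after all,
  because u \<alpha> is a root of unity.\<close>

section \<open>Extending field homomorphisms\<close>


text \<open>
  A homomorphism between subfields is represented by its graph, so that the upper bounds needed for
  Zorn's lemma are plain unions.
\<close>

definition partial_hom :: "('a::field \<times> 'b::field) set \<Rightarrow> bool"
  where "partial_hom R \<longleftrightarrow> (1, 1) \<in> R \<and>
    (\<forall>x y x' y'. (x, y) \<in> R \<longrightarrow> (x', y') \<in> R \<longrightarrow> (x + x', y + y') \<in> R \<and> (x * x', y * y') \<in> R) \<and>
    (\<forall>x y. (x, y) \<in> R \<longrightarrow> (- x, - y) \<in> R \<and> (inverse x, inverse y) \<in> R) \<and>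
    (\<forall>y. (0, y) \<in> R \<longrightarrow> y = 0)"

text \<open>All indices are compared, also those past the degree. This is harmless since
  \<open>(0, 0)\<close> belongs to a homomorphism graph, and it reduces sums and products of
  polynomials to closure properties of \<open>R\<close>.\<close>

definition poly_rel :: "('a::zero \<times> 'b::zero) set \<Rightarrow> 'a poly \<Rightarrow> 'b poly \<Rightarrow> bool"
  where "poly_rel R p q \<longleftrightarrow> (\<forall>i. (coeff p i, coeff q i) \<in> R)"

context
  fixes R :: "('a::field \<times> 'b::field) set"
  assumes R: "partial_hom R"
begin

lemma partial_hom_one: "(1, 1) \<in> R"
  and partial_hom_add: "(x, y) \<in> R \<Longrightarrow> (x', y') \<in> R \<Longrightarrow> (x + x', y + y') \<in> R"
  and partial_hom_mult: "(x, y) \<in> R \<Longrightarrow> (x', y') \<in> R \<Longrightarrow> (x * x', y * y') \<in> R"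
  and partial_hom_uminus: "(x, y) \<in> R \<Longrightarrow> (- x, - y) \<in> R"
  and partial_hom_inverse: "(x, y) \<in> R \<Longrightarrow> (inverse x, inverse y) \<in> R"
  and partial_hom_zeroD: "(0, y) \<in> R \<Longrightarrow> y = 0"
  using R unfolding partial_hom_def by blast+

lemma partial_hom_zero: "(0, 0) \<in> R"
  using partial_hom_add[OF partial_hom_one partial_hom_uminus[OF partial_hom_one]] by simp

lemma partial_hom_diff: "(x, y) \<in> R \<Longrightarrow> (x', y') \<in> R \<Longrightarrow> (x - x', y - y') \<in> R"
  using partial_hom_add[OF _ partial_hom_uminus] by fastforce

lemma partial_hom_unique: "(x, y) \<in> R \<Longrightarrow> (x, y') \<in> R \<Longrightarrow> y = y'"
  using partial_hom_diff[of x y x y'] partial_hom_zeroD[of "y - y'"] by simp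

lemma partial_hom_eq_0_iff: "(x, y) \<in> R \<Longrightarrow> x = 0 \<longleftrightarrow> y = 0"
proof -
  assume xy: "(x, y) \<in> R"
  have "x = 0" if "y = 0"
  proof (rule ccontr)
    assume "x \<noteq> 0"
    hence "(1, 0) \<in> R"
      using partial_hom_mult[OF xy partial_hom_inverse[OF xy]] that by simp
    thus False using partial_hom_unique[OF partial_hom_one, of 0] by simp
  qed
  thus ?thesis using partial_hom_zeroD xy by auto
qed

lemma partial_hom_sum:
  "(\<And>i. i \<in> I \<Longrightarrow> (f i, g i) \<in> R) \<Longrightarrow> (sum f I, sum g I) \<in> R"
  by (induction I rule: infinite_finite_induct) (auto intro: partial_hom_zero partial_hom_add)

lemma poly_rel_add: "poly_rel R p q \<Longrightarrow> poly_rel R p' q' \<Longrightarrow> poly_rel R (p + p') (q + q')"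
  and poly_rel_diff: "poly_rel R p q \<Longrightarrow> poly_rel R p' q' \<Longrightarrow> poly_rel R (p - p') (q - q')"
  and poly_rel_uminus: "poly_rel R p q \<Longrightarrow> poly_rel R (- p) (- q)"
  and poly_rel_mult: "poly_rel R p q \<Longrightarrow> poly_rel R p' q' \<Longrightarrow> poly_rel R (p * p') (q * q')"
  and poly_rel_monom: "(x, y) \<in> R \<Longrightarrow> poly_rel R (monom x n) (monom y n)"
  and poly_rel_const: "(x, y) \<in> R \<Longrightarrow> poly_rel R [:x:] [:y:]"
  unfolding poly_rel_def
  by (auto simp: coeff_mult coeff_pCons
      intro!: partial_hom_add partial_hom_diff partial_hom_uminus partial_hom_sum partial_hom_mult
        partial_hom_zero split: nat.splits)

lemma poly_rel_degree: "poly_rel R p q \<Longrightarrow> degree p = degree q"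
  unfolding poly_rel_def
  by (metis degree_le eq_iff le_degree leading_coeff_0_iff linorder_not_less partial_hom_eq_0_iff degree_0 le0
      coeff_eq_0)

lemma poly_rel_eq_0_iff: "poly_rel R p q \<Longrightarrow> p = 0 \<longleftrightarrow> q = 0"
  unfolding poly_rel_def poly_eq_iff using partial_hom_eq_0_iff by auto

lemma poly_rel_lead_coeff: "poly_rel R p q \<Longrightarrow> (lead_coeff p, lead_coeff q) \<in> R"
  using poly_rel_degree[of p q] by (simp add: poly_rel_def)

text \<open>Divide by \<open>P\<close>, which has least degree among the annihilators of \<open>x\<close>.\<close>

lemma poly_rel_minimal_root:
  assumes PQ: "poly_rel R P Q" "P \<noteq> 0" "poly P x = 0" "poly Q z = 0"
    and min: "\<And>p q. poly_rel R p q \<Longrightarrow> p \<noteq> 0 \<Longrightarrow> poly p x = 0 \<Longrightarrow> degree P \<le> degree p"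
    and pq: "poly_rel R p q" "poly p x = 0"
  shows "poly q z = 0"
  using pq
proof (induction "degree p" arbitrary: p q rule: less_induct)
  case less
  show ?case
  proof (cases "p = 0")
    case True
    thus ?thesis using poly_rel_eq_0_iff[OF less.prems(1)] by simp
  next
    case False
    let ?n = "degree p - degree P"
    have le: "degree P \<le> degree p"
      using min[OF less.prems(1) False less.prems(2)] .
    let ?l = "lead_coeff p * inverse (lead_coeff P)"
    let ?m = "lead_coeff q * inverse (lead_coeff Q)"
    let ?p = "p - monom ?l ?n * P" and ?q = "q - monom ?m ?n * Q"
    have rel: "poly_rel R ?p ?q"
      by (intro poly_rel_diff poly_rel_mult poly_rel_monom partial_hom_mult partial_hom_inverse
          poly_rel_lead_coeff less.prems PQ)
    have "degree ?p < degree p \<or> ?p = 0"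
    proof -
      have "degree (monom ?l ?n * P) = degree p"
        using le PQ(2) False by (subst degree_mult_eq) (auto simp: degree_monom_eq)
      moreover have "coeff (monom ?l ?n * P) (degree p) = coeff p (degree p)"
        using le PQ(2) by (simp add: coeff_monom_mult)
      ultimately show ?thesis
        by (metis (no_types, lifting) degree_diff_le_max coeff_diff eq_iff_diff_eq_0 leading_coeff_0_iff
            max.idem nat_less_le)
    qed
    moreover have "poly ?p x = 0" using less.prems PQ by simp
    moreover have "?q = 0" if "?p = 0" using poly_rel_eq_0_iff[OF rel] that by simp
    ultimately have "poly ?q z = 0" using less.hyps[OF _ rel] by fastforce
    thus ?thesis using PQ by simp
  qed
qed

lemma poly_rel_exists:
  assumes p: "\<forall>i. coeff p i \<in> Domain R"
  shows "\<exists>q. poly_rel R p q"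
proof -
  define q where "q = Poly (map (\<lambda>i. SOME w. (coeff p i, w) \<in> R) [0..<Suc (degree p)])"
  have "(coeff p i, coeff q i) \<in> R" for i
  proof (cases "i \<le> degree p")
    case True
    have "(coeff p i, SOME w. (coeff p i, w) \<in> R) \<in> R"
      using p by (metis DomainE someI_ex)
    thus ?thesis using True by (simp add: q_def nth_default_def del: upt_Suc)
  next
    case False
    thus ?thesis using partial_hom_zero
      by (simp add: q_def nth_default_def coeff_eq_0 del: upt_Suc)
  qed
  thus ?thesis by (auto simp: poly_rel_def)
qed

text \<open>The extension sends p(x) to q(z) for related p and q; it is well defined because
  \<open>z\<close> is a root of the image of everything that vanishes at \<open>x\<close>. Since all
  elements are algebraic over the domain, the ring generated by \<open>x\<close> is already a
  field.\<close>

lemma partial_hom_adjoin: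
  assumes alg: "\<And>y. \<exists>p. p \<noteq> 0 \<and> (\<forall>i. coeff p i \<in> Domain R) \<and> poly p y = 0"
    and z: "\<And>p q. poly_rel R p q \<Longrightarrow> poly p x = 0 \<Longrightarrow> poly q z = 0"
  shows "\<exists>R'. partial_hom R' \<and> R \<subseteq> R' \<and> (x, z) \<in> R'"
proof -
  define R' where "R' = {(poly p x, poly q z) |p q. poly_rel R p q}"
  have I: "(poly p x, poly q z) \<in> R'" if "poly_rel R p q" for p q
    using that unfolding R'_def by blast
  have E: "\<exists>p q. v = poly p x \<and> w = poly q z \<and> poly_rel R p q" if "(v, w) \<in> R'" for v w
    using that unfolding R'_def by blast
  have sub: "R \<subseteq> R'"
    using I[OF poly_rel_const] by auto
  have xz: "(x, z) \<in> R'"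
    using I[OF poly_rel_monom[OF partial_hom_one, of 1]] by (simp add: poly_monom)
  have zero: "w = 0" if "(0, w) \<in> R'" for w
    using E[OF that] z by metis
  have add: "(v + v', w + w') \<in> R'" and mult: "(v * v', w * w') \<in> R'"
    if "(v, w) \<in> R'" "(v', w') \<in> R'" for v w v' w'
    using E[OF that(1)] E[OF that(2)] I[OF poly_rel_add] I[OF poly_rel_mult]
    by (fastforce simp del: poly_add poly_mult simp: poly_add[symmetric] poly_mult[symmetric])+
  have uminus: "(- v, - w) \<in> R'" if "(v, w) \<in> R'" for v w
    using E[OF that] I[OF poly_rel_uminus] by fastforce
  have one: "(1, 1) \<in> R'" and zz: "(0, 0) \<in> R'" using sub partial_hom_one partial_hom_zero by auto
  have poly: "(poly p v, poly q w) \<in> R'" if "poly_rel R p q" "(v, w) \<in> R'" for p q v w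
  proof -
    have "(v ^ i, w ^ i) \<in> R'" for i
      by (induction i) (simp_all add: one mult[OF that(2)])
    hence *: "(coeff p i * v ^ i, coeff q i * w ^ i) \<in> R'" for i
      using that(1) sub by (intro mult) (auto simp: poly_rel_def)
    have "(\<Sum>i\<le>n. coeff p i * v ^ i, \<Sum>i\<le>n. coeff q i * w ^ i) \<in> R'" for n
    proof (induction n)
      case 0
      show ?case using *[of 0] by simp
    next
      case (Suc n)
      show ?case using add[OF Suc *[of "Suc n"]] by simp
    qed
    thus ?thesis
      using poly_rel_degree[OF that(1)] by (simp add: poly_altdef)
  qed
  have unique: "w = w'" if "(v, w) \<in> R'" "(v, w') \<in> R'" for v w w'
    using zero[of "w - w'"] add[OF that(1) uminus[OF that(2)]] by simp
  have inverse: "(inverse v, inverse w) \<in> R'" if vw: "(v, w) \<in> R'" for v w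
  proof (cases "v = 0")
    case True
    thus ?thesis using zero[of w] zz vw by simp
  next
    case False
    obtain p where p: "p \<noteq> 0" "\<forall>i. coeff p i \<in> Domain R" "poly p v = 0"
      using alg by blast
    \<comment> \<open>An annihilator of \<open>v\<close> of least degree has the form a + X q with a
      nonzero, so the inverse of \<open>v\<close> is -q(v)/a, a polynomial expression in
      \<open>v\<close>.\<close>
    define P where "P = (\<lambda>p. p \<noteq> 0 \<and> (\<forall>i. coeff p i \<in> Domain R) \<and> poly p v = 0)"
    obtain p where "P p" and min: "\<And>q. P q \<Longrightarrow> degree p \<le> degree q"
      using p ex_has_least_nat[of P p degree] by (auto simp: P_def)
    then obtain a q where pq: "p = pCons a q" "p \<noteq> 0" "poly p v = 0" "\<forall>i. coeff p i \<in> Domain R"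
      unfolding P_def by (metis pCons_cases)
    have q: "\<forall>i. coeff q i \<in> Domain R" and a: "a \<in> Domain R"
      using pq(4) unfolding pq(1) by (metis coeff_pCons_Suc, metis coeff_pCons_0)
    have "a \<noteq> 0"
    proof
      assume "a = 0"
      hence "P q" using pq q False unfolding P_def by auto
      thus False using min[of q] pq \<open>a = 0\<close> by (auto simp: degree_pCons_eq_if split: if_splits)
    qed
    have "v * (- inverse a * poly q v) = 1"
      using pq \<open>a \<noteq> 0\<close> by (simp add: field_simps add_eq_0_iff)
    hence inv: "inverse v = - inverse a * poly q v"
      by (rule inverse_unique)
    obtain q' where "poly_rel R q q'" using poly_rel_exists[OF q] by blast
    moreover obtain a' where "(a, a') \<in> R" using a by blast
    hence "(- inverse a, - inverse a') \<in> R'"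
      using sub partial_hom_uminus partial_hom_inverse by blast
    ultimately have "(inverse v, - inverse a' * poly q' w) \<in> R'"
      unfolding inv using vw by (intro mult poly)
    moreover from mult[OF vw this] have "w * (- inverse a' * poly q' w) = 1"
      using unique one False by fastforce
    hence "inverse w = - inverse a' * poly q' w" by (rule inverse_unique)
    ultimately show ?thesis by simp
  qed
  have "partial_hom R'"
    unfolding partial_hom_def by (intro conjI allI impI one add mult uminus inverse zero)
  thus ?thesis using sub xz by blast
qed

end

definition field_hom :: "('a::field \<Rightarrow> 'b::field) \<Rightarrow> bool"
  where "field_hom \<phi> \<longleftrightarrow> \<phi> 1 = 1 \<and> (\<forall>x y. \<phi> (x + y) = \<phi> x + \<phi> y) \<and> (\<forall>x y. \<phi> (x * y) = \<phi> x * \<phi> y)"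

lemma partial_hom_minimal_pair:
  fixes R :: "('a::field \<times> 'b::field) set"
  assumes R: "partial_hom R"
    and alg: "\<exists>p. p \<noteq> 0 \<and> (\<forall>i. coeff p i \<in> Domain R) \<and> poly p x = 0"
  obtains P Q where "poly_rel R P Q" "P \<noteq> 0" "poly P x = 0"
    "\<And>p q. poly_rel R p q \<Longrightarrow> p \<noteq> 0 \<Longrightarrow> poly p x = 0 \<Longrightarrow> degree P \<le> degree p"
proof -
  define S where "S = (\<lambda>p. p \<noteq> 0 \<and> (\<exists>q. poly_rel R p q) \<and> poly p x = 0)"
  obtain p where "S p" using alg poly_rel_exists[OF R] unfolding S_def by blast
  then obtain P where "S P" "\<And>p. S p \<Longrightarrow> degree P \<le> degree p"
    using ex_has_least_nat[of S p degree] by blast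
  thus thesis using that unfolding S_def by blast
qed

text \<open>A maximal extension has full domain: the image of the minimal polynomial of any
  \<open>x\<close> has a root in the algebraically closed target, and sending \<open>x\<close> to it
  would extend the homomorphism further.\<close>

theorem partial_hom_extend:
  fixes R :: "('a::field \<times> 'b::alg_closed_field) set"
  assumes R: "partial_hom R"
    and alg: "\<And>y. \<exists>p. p \<noteq> 0 \<and> (\<forall>i. coeff p i \<in> Domain R) \<and> poly p y = 0"
  shows "\<exists>\<phi>. field_hom \<phi> \<and> (\<forall>x y. (x, y) \<in> R \<longrightarrow> \<phi> x = y)"
proof -
  define \<A> where "\<A> = {S. partial_hom S \<and> R \<subseteq> S}"
  have "\<exists>M\<in>\<A>. \<forall>S\<in>\<A>. M \<subseteq> S \<longrightarrow> S = M"
  proof (rule subset_Zorn_nonempty)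
    show "\<A> \<noteq> {}" using R by (auto simp: \<A>_def)
    fix \<C> assume "\<C> \<noteq> {}" and chain: "subset.chain \<A> \<C>"
    have hom: "partial_hom S" if "S \<in> \<C>" for S
      using chain that by (auto simp: subset.chain_def \<A>_def)
    \<comment> \<open>Sums and products involve two pairs at once; in a chain both lie in one
      member.\<close>
    have two: "\<exists>S\<in>\<C>. v \<in> S \<and> w \<in> S" if vw: "v \<in> \<Union>\<C>" "w \<in> \<Union>\<C>" for v w
    proof -
      from vw obtain S1 S2 where "S1 \<in> \<C>" "S2 \<in> \<C>" "v \<in> S1" "w \<in> S2" by blast
      moreover have "S1 \<subseteq> S2 \<or> S2 \<subseteq> S1"
        using chain calculation by (auto simp: subset.chain_def)
      ultimately show ?thesis by blast
    qed
    have "partial_hom (\<Union>\<C>)"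
      unfolding partial_hom_def
    proof (intro conjI allI impI)
      show "(1, 1) \<in> \<Union>\<C>" using \<open>\<C> \<noteq> {}\<close> hom partial_hom_one by blast
      show "(x + x', y + y') \<in> \<Union>\<C>" "(x * x', y * y') \<in> \<Union>\<C>"
        if "(x, y) \<in> \<Union>\<C>" "(x', y') \<in> \<Union>\<C>" for x y x' y'
        using two[OF that] hom partial_hom_add partial_hom_mult by blast+
      show "(- x, - y) \<in> \<Union>\<C>" "(inverse x, inverse y) \<in> \<Union>\<C>" if "(x, y) \<in> \<Union>\<C>" for x y
        using that hom partial_hom_uminus partial_hom_inverse by blast+
      show "y = 0" if "(0, y) \<in> \<Union>\<C>" for y
        using that hom partial_hom_zeroD by blast
    qed
    moreover have "R \<subseteq> \<Union>\<C>"
      using \<open>\<C> \<noteq> {}\<close> chain unfolding subset.chain_def \<A>_def by blast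
    ultimately show "\<Union>\<C> \<in> \<A>" by (simp add: \<A>_def)
  qed
  then obtain M where M: "partial_hom M" "R \<subseteq> M"
    and max: "\<And>S. partial_hom S \<Longrightarrow> M \<subseteq> S \<Longrightarrow> S = M"
    by (force simp: \<A>_def)
  have algM: "\<exists>p. p \<noteq> 0 \<and> (\<forall>i. coeff p i \<in> Domain M) \<and> poly p y = 0" for y
    using alg[of y] M(2) by blast
  have "\<exists>z. (x, z) \<in> M" for x
  proof -
    obtain P Q where PQ: "poly_rel M P Q" "P \<noteq> 0" "poly P x = 0"
      "\<And>p q. poly_rel M p q \<Longrightarrow> p \<noteq> 0 \<Longrightarrow> poly p x = 0 \<Longrightarrow> degree P \<le> degree p"
      using partial_hom_minimal_pair[OF M(1) algM[of x]] by metis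
    have "degree P \<noteq> 0" using PQ(2,3) by (metis degree_eq_zeroE poly_const_conv pCons_0_0)
    hence "degree Q > 0" using poly_rel_degree[OF M(1) PQ(1)] by simp
    then obtain z where z: "poly Q z = 0" using alg_closed_imp_poly_has_root by blast
    have "poly q z = 0" if "poly_rel M p q" "poly p x = 0" for p q
      by (rule poly_rel_minimal_root[OF M(1) PQ(1-3) z _ that]) (rule PQ(4))
    hence "\<exists>S. partial_hom S \<and> M \<subseteq> S \<and> (x, z) \<in> S"
      by (intro partial_hom_adjoin M(1) algM)
    then obtain S where S: "partial_hom S" "M \<subseteq> S" "(x, z) \<in> S" by blast
    from max[OF S(1,2)] S(3) show ?thesis by auto
  qed
  then obtain \<phi> where \<phi>: "\<And>x. (x, \<phi> x) \<in> M" by metis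
  have eq: "\<phi> x = y" if "(x, y) \<in> M" for x y
    using partial_hom_unique[OF M(1) \<phi> that] .
  have "field_hom \<phi>"
    unfolding field_hom_def
    by (intro conjI allI eq \<phi> partial_hom_one[OF M(1)] partial_hom_add[OF M(1)] partial_hom_mult[OF M(1)])
  thus ?thesis using eq M(2) by blast
qed

section \<open>Automorphisms of an algebraically closed field\<close>


lemma field_hom_add: "field_hom \<phi> \<Longrightarrow> \<phi> (x + y) = \<phi> x + \<phi> y"
  and field_hom_mult: "field_hom \<phi> \<Longrightarrow> \<phi> (x * y) = \<phi> x * \<phi> y"
  and field_hom_1: "field_hom \<phi> \<Longrightarrow> \<phi> 1 = 1"
  by (auto simp: field_hom_def)

lemma field_hom_0: "field_hom \<phi> \<Longrightarrow> \<phi> 0 = 0"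
  using field_hom_add[of \<phi> 0 0] by (metis add_cancel_right_right)

lemma field_hom_uminus: "field_hom \<phi> \<Longrightarrow> \<phi> (- x) = - \<phi> x"
  using field_hom_add[of \<phi> x "- x"] by (simp add: field_hom_0 add_eq_0_iff)

lemma field_hom_diff: "field_hom \<phi> \<Longrightarrow> \<phi> (x - y) = \<phi> x - \<phi> y"
  using field_hom_add[of \<phi> x "- y"] by (simp add: field_hom_uminus)

lemma field_hom_eq_0_iff: "field_hom \<phi> \<Longrightarrow> \<phi> x = 0 \<longleftrightarrow> x = 0"
  using field_hom_mult[of \<phi> x "inverse x"] by (cases "x = 0") (auto simp: field_hom_0 field_hom_1)

lemma field_hom_inj: "field_hom \<phi> \<Longrightarrow> inj \<phi>"
  using field_hom_eq_0_iff[of \<phi>] field_hom_diff[of \<phi>] by (intro injI) (metis eq_iff_diff_eq_0)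

lemma field_hom_inverse: "field_hom \<phi> \<Longrightarrow> \<phi> (inverse x) = inverse (\<phi> x)"
  using field_hom_mult[of \<phi> x "inverse x"]
  by (cases "x = 0") (auto simp: field_hom_0 field_hom_1 intro: inverse_unique[symmetric])

lemma field_hom_divide: "field_hom \<phi> \<Longrightarrow> \<phi> (x / y) = \<phi> x / \<phi> y"
  by (simp add: divide_inverse field_hom_mult field_hom_inverse)

lemma field_hom_power: "field_hom \<phi> \<Longrightarrow> \<phi> (x ^ n) = \<phi> x ^ n"
  by (induction n) (simp_all add: field_hom_1 field_hom_mult)

lemma field_hom_of_nat: "field_hom \<phi> \<Longrightarrow> \<phi> (of_nat n) = of_nat n"
  by (induction n) (simp_all add: field_hom_0 field_hom_1 field_hom_add)

lemma field_hom_of_int: "field_hom \<phi> \<Longrightarrow> \<phi> (of_int n) = of_int n"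
  by (cases n rule: int_diff_cases) (simp add: field_hom_diff field_hom_of_nat)

lemma field_hom_Rats: "field_hom \<phi> \<Longrightarrow> x \<in> \<rat> \<Longrightarrow> \<phi> x = x"
  by (auto elim!: Rats_cases' simp: field_hom_divide field_hom_of_int)

lemma field_hom_sum: "field_hom \<phi> \<Longrightarrow> \<phi> (sum f I) = (\<Sum>i\<in>I. \<phi> (f i))"
  by (induction I rule: infinite_finite_induct) (simp_all add: field_hom_0 field_hom_add)

lemma field_hom_poly:
  assumes "field_hom \<phi>"
  shows "\<phi> (poly p x) = poly (map_poly \<phi> p) (\<phi> x)"
  by (induction p) (simp_all add: assms field_hom_0 field_hom_add field_hom_mult map_poly_pCons)

lemma field_hom_map_poly_mult:
  assumes "field_hom \<phi>"
  shows "map_poly \<phi> (p * q) = map_poly \<phi> p * map_poly \<phi> q"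
  by (simp add: poly_eq_iff coeff_map_poly field_hom_0 coeff_mult field_hom_sum field_hom_mult assms)

lemma field_hom_map_poly_prod_linear:
  assumes "field_hom \<phi>"
  shows "map_poly \<phi> (\<Prod>y\<in>Y. [:- y, 1:]) = (\<Prod>y\<in>Y. [:- \<phi> y, 1:])"
  by (induction Y rule: infinite_finite_induct)
    (simp_all add: field_hom_map_poly_mult[OF assms] map_poly_pCons field_hom_0[OF assms]
      field_hom_1[OF assms] field_hom_uminus[OF assms] del: mult_pCons_left)

lemma field_hom_comp: "field_hom \<phi> \<Longrightarrow> field_hom \<psi> \<Longrightarrow> field_hom (\<phi> \<circ> \<psi>)"
  by (simp add: field_hom_def)

text \<open>The maps act on the whole ambient type and \<open>A\<close> is an arbitrary set, so that
  a base field can be traded for a finite set of generators.\<close>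

definition field_auts :: "'a::field set \<Rightarrow> ('a \<Rightarrow> 'a) set"
  where "field_auts A = {\<sigma>. field_hom \<sigma> \<and> bij \<sigma> \<and> (\<forall>x\<in>A. \<sigma> x = x)}"

text \<open>Plays the part of the field generated by \<open>A\<close> over the rationals. Defined by
  invariance, it makes membership a computation with automorphisms.\<close>

definition fixed_field :: "'a::field set \<Rightarrow> 'a set"
  where "fixed_field A = {x. \<forall>\<sigma>\<in>field_auts A. \<sigma> x = x}"

lemma field_auts_hom: "\<sigma> \<in> field_auts A \<Longrightarrow> field_hom \<sigma>"
  and field_auts_bij: "\<sigma> \<in> field_auts A \<Longrightarrow> bij \<sigma>"
  and field_auts_fixes: "\<sigma> \<in> field_auts A \<Longrightarrow> x \<in> A \<Longrightarrow> \<sigma> x = x"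
  by (auto simp: field_auts_def)

lemma field_auts_mono: "A \<subseteq> B \<Longrightarrow> field_auts B \<subseteq> field_auts A"
  by (auto simp: field_auts_def)

lemma field_auts_id: "id \<in> field_auts A"
  by (simp add: field_auts_def field_hom_def)

lemma field_auts_comp: "\<sigma> \<in> field_auts A \<Longrightarrow> \<tau> \<in> field_auts A \<Longrightarrow> \<sigma> \<circ> \<tau> \<in> field_auts A"
  by (simp add: field_auts_def field_hom_comp bij_comp)

lemma field_auts_inv:
  assumes "\<sigma> \<in> field_auts A"
  shows "inv_into UNIV \<sigma> \<in> field_auts A"
proof -
  have b: "\<sigma> (inv_into UNIV \<sigma> x) = x" "inv_into UNIV \<sigma> (\<sigma> x) = x" for x
    using field_auts_bij[OF assms] by (simp_all add: bij_is_surj surj_f_inv_f bij_is_inj)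
  have h: "field_hom \<sigma>" by (rule field_auts_hom[OF assms])
  have "inv_into UNIV \<sigma> (x + y) = inv_into UNIV \<sigma> x + inv_into UNIV \<sigma> y"
    "inv_into UNIV \<sigma> (x * y) = inv_into UNIV \<sigma> x * inv_into UNIV \<sigma> y" for x y
    by (metis b field_hom_add[OF h], metis b field_hom_mult[OF h])
  moreover have "inv_into UNIV \<sigma> 1 = 1" by (metis b field_hom_1[OF h])
  moreover have "inv_into UNIV \<sigma> x = x" if "x \<in> A" for x by (metis b field_auts_fixes[OF assms that])
  ultimately show ?thesis
    using field_auts_bij[OF assms] by (simp add: field_auts_def field_hom_def bij_imp_bij_inv)
qed

lemma fixed_fieldD: "x \<in> fixed_field A \<Longrightarrow> \<sigma> \<in> field_auts A \<Longrightarrow> \<sigma> x = x"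
  by (simp add: fixed_field_def)

lemma fixed_field_mult: "x \<in> fixed_field A \<Longrightarrow> y \<in> fixed_field A \<Longrightarrow> x * y \<in> fixed_field A"
  and fixed_field_divide: "x \<in> fixed_field A \<Longrightarrow> y \<in> fixed_field A \<Longrightarrow> x / y \<in> fixed_field A"
  and fixed_field_power: "x \<in> fixed_field A \<Longrightarrow> x ^ n \<in> fixed_field A"
  and fixed_field_of_int: "of_int k \<in> fixed_field A"
  by (auto simp: fixed_field_def field_hom_mult[OF field_auts_hom[of _ A]]
      field_hom_divide[OF field_auts_hom[of _ A]] field_hom_power[OF field_auts_hom[of _ A]]
      field_hom_of_int[OF field_auts_hom[of _ A]])

lemma partial_hom_Id_onI:
  assumes "1 \<in> A" "\<And>x y. x \<in> A \<Longrightarrow> y \<in> A \<Longrightarrow> x + y \<in> A" "\<And>x y. x \<in> A \<Longrightarrow> y \<in> A \<Longrightarrow> x * y \<in> A"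
    "\<And>x. x \<in> A \<Longrightarrow> - x \<in> A" "\<And>x. x \<in> A \<Longrightarrow> inverse x \<in> A"
  shows "partial_hom (Id_on A)"
  using assms by (auto simp: partial_hom_def)

text \<open>A homomorphism fixing \<open>A\<close> maps the finite root set of a polynomial over
  \<open>A\<close> injectively into itself, hence onto it.\<close>

lemma hom_over_algebraic_bij:
  fixes \<phi> :: "'a::field \<Rightarrow> 'a"
  assumes \<phi>: "field_hom \<phi>" "\<And>x. x \<in> A \<Longrightarrow> \<phi> x = x"
    and alg: "\<And>y. \<exists>p. p \<noteq> 0 \<and> (\<forall>i. coeff p i \<in> A) \<and> poly p y = 0"
  shows "\<phi> \<in> field_auts A"
proof -
  have "surj \<phi>"
  proof (rule surjI[of _ "inv_into UNIV \<phi>"])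
    fix y
    obtain p where p: "p \<noteq> 0" "\<forall>i. coeff p i \<in> A" "poly p y = 0" using alg by blast
    let ?S = "{x. poly p x = 0}"
    have "map_poly \<phi> p = p" using p(2) \<phi>(2) by (simp add: poly_eq_iff coeff_map_poly field_hom_0[OF \<phi>(1)])
    hence "poly p (\<phi> x) = 0" if "poly p x = 0" for x
      using field_hom_poly[OF \<phi>(1), of p x] that by (simp add: field_hom_0[OF \<phi>(1)])
    hence "\<phi> ` ?S \<subseteq> ?S" by blast
    moreover have "finite ?S" using p(1) poly_roots_finite by blast
    ultimately have "\<phi> ` ?S = ?S"
      using field_hom_inj[OF \<phi>(1)] by (intro endo_inj_surj) (auto intro: inj_on_subset)
    hence "y \<in> range \<phi>" using p(3) by blast
    thus "\<phi> (inv_into UNIV \<phi> y) = y" by (rule f_inv_into_f)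
  qed
  thus ?thesis using field_hom_inj[OF \<phi>(1)] \<phi> by (simp add: field_auts_def bij_def)
qed

text \<open>The hypothesis on \<open>Id_on A\<close> says that \<open>A\<close> is a subfield. The
  minimal polynomial of \<open>x\<close> over it has a second root \<open>z\<close>, and
  \<open>x\<close> to \<open>z\<close> extends to an automorphism.\<close>

theorem field_auts_moves:
  fixes A :: "'a::{alg_closed_field, field_char_0} set"
  assumes A: "partial_hom (Id_on A)"
    and alg: "\<And>y. \<exists>p. p \<noteq> 0 \<and> (\<forall>i. coeff p i \<in> A) \<and> poly p y = 0"
    and x: "x \<notin> A"
  shows "\<exists>\<sigma>\<in>field_auts A. \<sigma> x \<noteq> x"
proof -
  have alg': "\<exists>p. p \<noteq> 0 \<and> (\<forall>i. coeff p i \<in> Domain (Id_on A)) \<and> poly p y = 0" for y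
    using alg by simp
  obtain P Q where PQ: "poly_rel (Id_on A) P Q" "P \<noteq> 0" "poly P x = 0"
    and min: "\<And>p q. poly_rel (Id_on A) p q \<Longrightarrow> p \<noteq> 0 \<Longrightarrow> poly p x = 0 \<Longrightarrow> degree P \<le> degree p"
    by (rule partial_hom_minimal_pair[OF A alg'[of x]]) blast
  have "Q = P" using PQ(1) by (auto simp: poly_rel_def poly_eq_iff)
  have coeffA: "coeff P i \<in> A" for i using PQ(1) by (auto simp: poly_rel_def)
  have "\<exists>z. poly P z = 0 \<and> z \<noteq> x"
  proof (rule ccontr)
    assume "\<not> ?thesis"
    hence only: "poly P z = 0 \<Longrightarrow> z = x" for z by blast
    obtain B where B: "size B = degree P" "P = smult (lead_coeff P) (\<Prod>x\<in>#B. [:-x, 1:])"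
      using alg_closed_imp_factorization[OF PQ(2)] by blast
    have "z = x" if "z \<in># B" for z
    proof (rule only)
      obtain C where "B = add_mset z C" using multi_member_split[OF \<open>z \<in># B\<close>] by blast
      thus "poly P z = 0" by (subst B(2)) simp
    qed
    hence "B = replicate_mset (degree P) x"
      using set_mset_subset_singletonD[of B x] B(1) by auto
    hence P: "P = smult (lead_coeff P) ([:-x, 1:] ^ degree P)"
      by (subst B(2)) simp
    have "degree P \<noteq> 0"
      using PQ(2,3) by (metis degree_eq_zeroE poly_const_conv pCons_0_0)
    then obtain n where n: "degree P = Suc n" by (cases "degree P") auto
    \<comment> \<open>If \<open>x\<close> were the only root, P would be l (X - x)^(n+1), and its
      coefficient -(n+1) l x next to the leading one would put \<open>x\<close> into
      \<open>A\<close>. Dividing by n+1 is where characteristic zero enters.\<close>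
    have "coeff P n = lead_coeff P * (of_nat (Suc n) * - x)"
      by (subst P) (simp add: n coeff_linear_poly_power del: of_nat_Suc power_Suc)
    hence "x = - (coeff P n * inverse (lead_coeff P) * inverse (of_nat (Suc n)))"
      using PQ(2) by (simp add: field_simps del: of_nat_Suc)
    moreover have nat: "(of_nat k, of_nat k) \<in> Id_on A" for k
      by (induction k)
        (simp_all only: of_nat_0 of_nat_Suc partial_hom_zero[OF A] partial_hom_add[OF A partial_hom_one[OF A]])
    hence "(x', x') \<in> Id_on A" if "x' = - (coeff P n * inverse (lead_coeff P) * inverse (of_nat (Suc n)))" for x'
      unfolding that
      by (intro partial_hom_uminus[OF A] partial_hom_mult[OF A] partial_hom_inverse[OF A])
        (use coeffA nat in blast)+
    ultimately show False using x by blast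
  qed
  then obtain z where z: "poly P z = 0" "z \<noteq> x" by blast
  have "poly q z = 0" if "poly_rel (Id_on A) p q" "poly p x = 0" for p q
  proof (rule poly_rel_minimal_root[OF A PQ(1-3) _ _ that])
    show "poly Q z = 0" using z(1) \<open>Q = P\<close> by simp
  qed (rule min)
  hence "\<exists>S. partial_hom S \<and> Id_on A \<subseteq> S \<and> (x, z) \<in> S"
    by (intro partial_hom_adjoin A alg')
  then obtain S where S: "partial_hom S" "Id_on A \<subseteq> S" "(x, z) \<in> S" by blast
  have "\<exists>p. p \<noteq> 0 \<and> (\<forall>i. coeff p i \<in> Domain S) \<and> poly p y = 0" for y
    using alg'[of y] S(2) by blast
  from partial_hom_extend[OF S(1) this] obtain \<phi>
    where \<phi>: "field_hom \<phi>" "\<And>x y. (x, y) \<in> S \<Longrightarrow> \<phi> x = y" by blast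
  have "\<phi> \<in> field_auts A"
    using \<phi> S(2) by (intro hom_over_algebraic_bij alg) auto
  thus ?thesis using \<phi>(2)[OF S(3)] z(2) by blast
qed

section \<open>Fields algebraic over the rationals: complex embeddings, rational fixed points,
  finite orbits\<close>

lemma algebraic_over_Rats:
  fixes y :: "'a::field_char_0"
  assumes "algebraic y"
  shows "\<exists>p. p \<noteq> 0 \<and> (\<forall>i. coeff p i \<in> \<rat>) \<and> poly p y = 0"
  using assms Ints_subset_Rats unfolding algebraic_def by blast

lemma partial_hom_Rats:
  "partial_hom {(of_rat q :: 'a::field_char_0, of_rat q :: 'b::field_char_0) |q. True}"
  unfolding partial_hom_def
  by (auto simp flip: of_rat_add of_rat_mult of_rat_minus of_rat_inverse)

lemma partial_hom_Id_on_Rats: "partial_hom (Id_on (\<rat> :: 'a::field_char_0 set))"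
  by (intro partial_hom_Id_onI) auto

lemma exists_complex_embedding:
  assumes "\<And>x::'a::field_char_0. algebraic x"
  shows "\<exists>\<iota>::'a \<Rightarrow> complex. field_hom \<iota>"
proof -
  let ?R = "{(of_rat q :: 'a, of_rat q :: complex) |q. True}"
  have "Domain ?R = \<rat>" by (auto simp: Rats_def)
  hence "\<exists>p. p \<noteq> 0 \<and> (\<forall>i. coeff p i \<in> Domain ?R) \<and> poly p y = 0" for y
    using algebraic_over_Rats[OF assms] by simp
  from partial_hom_extend[OF partial_hom_Rats this] show ?thesis by blast
qed

lemma fixed_field_empty:
  fixes x :: "'a::{alg_closed_field, field_char_0}"
  assumes alg: "\<And>x::'a. algebraic x" and "x \<in> fixed_field {}"
  shows "x \<in> \<rat>"
proof (rule ccontr)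
  assume "x \<notin> \<rat>"
  then obtain \<sigma> where "\<sigma> \<in> field_auts \<rat>" "\<sigma> x \<noteq> x"
    using field_auts_moves[OF partial_hom_Id_on_Rats algebraic_over_Rats[OF alg]] by blast
  moreover have "\<sigma> \<in> field_auts {}"
    using calculation field_auts_mono[of "{}" \<rat>] by blast
  ultimately show False using assms(2) by (auto simp: fixed_field_def)
qed

text \<open>All images are roots of one integer polynomial. The target type stays free so as to
  cover both conjugates in the ambient field and complex embeddings.\<close>

lemma finite_orbit:
  fixes x :: "'a::field_char_0"
  assumes "algebraic x"
  shows "finite ((\<lambda>\<sigma>. \<sigma> x) ` {\<sigma> :: 'a \<Rightarrow> 'b::field_char_0. field_hom \<sigma>})"
proof -
  obtain p :: "int poly" where p: "p \<noteq> 0" "poly (map_poly of_int p) x = 0"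
    using assms by (erule algebraicE')
  have "poly (map_poly of_int p) (\<sigma> x) = 0" if "field_hom \<sigma>" for \<sigma> :: "'a \<Rightarrow> 'b"
  proof -
    have "map_poly \<sigma> (map_poly of_int p) = map_poly of_int p"
      by (simp add: poly_eq_iff coeff_map_poly field_hom_0[OF that] field_hom_of_int[OF that])
    thus ?thesis using field_hom_poly[OF that, of "map_poly of_int p" x] p(2) field_hom_0[OF that] by simp
  qed
  moreover have "finite {y :: 'b. poly (map_poly of_int p) y = 0}"
    using p(1) by (intro poly_roots_finite) (simp add: map_poly_eq_0_iff)
  ultimately show ?thesis
    by (rule_tac finite_subset[of _ "{y :: 'b. poly (map_poly of_int p) y = 0}"]) auto
qed

section \<open>Northcott finiteness\<close>


lemma common_denominator:
  fixes p :: "'a::field_char_0 poly"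
  assumes "\<forall>i. coeff p i \<in> \<rat>"
  shows "\<exists>m q. m > 0 \<and> smult (of_int m) p = map_poly of_int q"
  using assms
proof (induction p)
  case 0
  show ?case by (rule exI[of _ 1], rule exI[of _ 0]) simp
next
  case (pCons a p)
  have "coeff p i \<in> \<rat>" for i using pCons.prems[rule_format, of "Suc i"] by simp
  then obtain m q where mq: "m > 0" "smult (of_int m) p = map_poly of_int q" using pCons.IH by blast
  have "a \<in> \<rat>" using pCons.prems[rule_format, of 0] by simp
  then obtain k n where kn: "n > 0" "a = of_int k / of_int n" by (auto elim: Rats_cases')
  have "smult (of_int (m * n)) (pCons a p) = map_poly of_int (pCons (m * k) (smult n q))"
    using kn arg_cong[OF mq(2), of "smult (of_int n)"]
    by (simp add: map_poly_pCons map_poly_smult mult.commute)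
  thus ?case using mq(1) kn(1) by (metis mult_pos_pos)
qed

text \<open>
  Gauss's lemma: clear denominators to \<open>m A\<close> and \<open>n B\<close>; their contents divide \<open>m\<close> and \<open>n\<close>, and
  multiplicativity of the content forces equality.
\<close>

lemma monic_factor_Ints:
  fixes A B :: "'a::field_char_0 poly"
  assumes monic: "lead_coeff A = 1" "lead_coeff B = 1"
    and rat: "\<forall>i. coeff A i \<in> \<rat>" "\<forall>i. coeff B i \<in> \<rat>"
    and int: "\<forall>i. coeff (A * B) i \<in> \<int>"
  shows "coeff A i \<in> \<int>"
proof -
  obtain m A' where A': "m > 0" "smult (of_int m) A = map_poly of_int A'"
    using common_denominator[OF rat(1)] by blast
  obtain n B' where B': "n > 0" "smult (of_int n) B = map_poly of_int B'"
    using common_denominator[OF rat(2)] by blast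
  have cA: "of_int (coeff A' i) = of_int m * coeff A i" for i
    using arg_cong[OF A'(2), of "\<lambda>p. coeff p i"] by (simp add: coeff_map_poly)
  have cB: "of_int (coeff B' i) = of_int n * coeff B i" for i
    using arg_cong[OF B'(2), of "\<lambda>p. coeff p i"] by (simp add: coeff_map_poly)
  have "(of_int (coeff A' (degree A)) :: 'a) = of_int m" "(of_int (coeff B' (degree B)) :: 'a) = of_int n"
    using cA[of "degree A"] cB[of "degree B"] monic by simp_all
  hence lead: "coeff A' (degree A) = m" "coeff B' (degree B) = n" by simp_all
  have dvd: "content A' dvd m" "content B' dvd n"
    using content_dvd_coeff[of A' "degree A"] content_dvd_coeff[of B' "degree B"] lead by simp_all
  have cAB: "of_int (coeff (A' * B') i) = of_int (m * n) * coeff (A * B) i" for i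
    by (simp add: coeff_mult cA cB sum_distrib_left mult_ac)
  have "m * n dvd coeff (A' * B') i" for i
  proof -
    obtain k where "coeff (A * B) i = of_int k" using int by (auto elim: Ints_cases)
    hence "(of_int (coeff (A' * B') i) :: 'a) = of_int (m * n * k)" using cAB[of i] by simp
    hence "coeff (A' * B') i = m * n * k" by (simp only: of_int_eq_iff)
    thus ?thesis by simp
  qed
  hence "m * n dvd content (A' * B')"
    by (simp flip: const_poly_dvd_iff_dvd_content add: const_poly_dvd_iff)
  hence "m * n dvd content A' * content B'" by (simp add: content_mult)
  moreover have "content A' > 0" "content B' > 0"
  proof -
    have "content A' \<ge> 0" "content B' \<ge> 0"
      using normalize_content[of A'] normalize_content[of B'] by simp_all
    moreover have "content A' \<noteq> 0" "content B' \<noteq> 0" using dvd A'(1) B'(1) by auto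
    ultimately show "content A' > 0" "content B' > 0" by linarith+
  qed
  ultimately have "m * n \<le> content A' * content B'" by (simp add: zdvd_imp_le)
  moreover have "content A' \<le> m" "content B' \<le> n"
    using dvd A'(1) B'(1) by (auto intro: zdvd_imp_le)
  moreover have "content A' * content B' < m * n" if "content A' < m"
    using that \<open>content A' > 0\<close> \<open>content B' \<le> n\<close> \<open>content B' > 0\<close> A'(1) by (intro mult_less_le_imp_less) auto
  ultimately have "content A' = m" by linarith
  hence "m dvd coeff A' i" using content_dvd_coeff[of A' i] by simp
  then obtain k where "coeff A' i = m * k" by blast
  hence "of_int m * coeff A i = of_int m * of_int k" by (metis cA of_int_mult)
  hence "coeff A i = of_int k" using A'(1) by auto
  thus ?thesis by simp
qed

lemma finite_bounded_int_polys:
  "finite {p :: int poly. degree p \<le> n \<and> (\<forall>i. \<bar>coeff p i\<bar> \<le> M)}"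
proof (rule finite_subset)
  show "{p :: int poly. degree p \<le> n \<and> (\<forall>i. \<bar>coeff p i\<bar> \<le> M)}
      \<subseteq> Poly ` {xs. set xs \<subseteq> {- M..M} \<and> length xs = Suc n}"
  proof safe
    fix p :: "int poly" assume p: "degree p \<le> n" "\<forall>i. \<bar>coeff p i\<bar> \<le> M"
    have "p = Poly (map (coeff p) [0..<Suc n])"
      using p(1) by (auto simp: poly_eq_iff nth_default_def coeff_eq_0 simp del: upt_Suc)
    moreover have "set (map (coeff p) [0..<Suc n]) \<subseteq> {- M..M}"
      using p(2) by (auto simp: abs_le_iff minus_le_iff)
    ultimately show "p \<in> Poly ` {xs. set xs \<subseteq> {- M..M} \<and> length xs = Suc n}"
      by (intro image_eqI[of _ _ "map (coeff p) [0..<Suc n]"]) auto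
  qed
  show "finite (Poly ` {xs. set xs \<subseteq> {- M..M :: int} \<and> length xs = Suc n})"
    by (intro finite_imageI finite_lists_length_eq) simp
qed

text \<open>Multiplying by a monic linear factor whose root has modulus at most \<open>B\<close>
  enlarges a bound on the coefficients by the factor \<open>1 + B\<close>.\<close>

lemma norm_coeff_prod_linear_le:
  fixes f :: "'b \<Rightarrow> complex"
  assumes "\<And>y. y \<in> Y \<Longrightarrow> cmod (f y) \<le> B" "B \<ge> 0"
  shows "cmod (coeff (\<Prod>y\<in>Y. [:- f y, 1:]) i) \<le> (1 + B) ^ card Y"
  using assms(1)
proof (induction Y arbitrary: i rule: infinite_finite_induct)
  case (insert y Y)
  let ?P = "\<Prod>y\<in>Y. [:- f y, 1:]"
  have *: "cmod (coeff ?P i) \<le> (1 + B) ^ card Y" for i using insert by simp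
  have "coeff (\<Prod>y\<in>insert y Y. [:- f y, 1:]) i = (case i of 0 \<Rightarrow> 0 | Suc j \<Rightarrow> coeff ?P j) - f y * coeff ?P i"
    using insert.hyps by (simp add: coeff_pCons)
  also have "cmod \<dots> \<le> (1 + B) ^ card Y + B * (1 + B) ^ card Y"
    using * insert.prems[of y] assms(2)
    by (intro order_trans[OF norm_triangle_ineq4] add_mono)
      (auto simp: norm_mult split: nat.split intro!: mult_mono)
  finally show ?case using insert.hyps by (simp add: algebra_simps)
qed (auto simp: coeff_1)

lemma prod_linear_dvd:
  fixes p :: "'a::field poly"
  assumes "finite Y" "\<And>y. y \<in> Y \<Longrightarrow> poly p y = 0"
  shows "(\<Prod>y\<in>Y. [:- y, 1:]) dvd p"
  using assms
proof (induction Y arbitrary: p rule: finite_induct)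
  case (insert y Y)
  obtain q where q: "p = [:- y, 1:] * q"
    using insert.prems[of y] by (auto simp: poly_eq_0_iff_dvd)
  have "poly q z = 0" if "z \<in> Y" for z
    using insert.prems[of z] insert.hyps that unfolding q by auto
  hence "(\<Prod>y\<in>Y. [:- y, 1:]) dvd q" by (rule insert.IH)
  thus ?case using insert.hyps unfolding q by (simp del: mult_pCons_left)
qed simp

text \<open>The value \<sigma> x depends only on the restriction of \<sigma> to \<open>A\<close>: if
  \<sigma> and \<tau> agree there, the inverse of \<tau> after \<sigma> fixes \<open>A\<close> and
  hence x. The number of such restrictions is finite and does not depend on x.\<close>

lemma orbit_bounded:
  fixes A :: "'a::field_char_0 set"
  assumes alg: "\<And>x::'a. algebraic x" and "finite A"
  shows "\<exists>C. \<forall>x\<in>fixed_field A. card ((\<lambda>\<sigma>. \<sigma> x) ` field_auts {}) \<le> C"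
proof -
  let ?r = "\<lambda>\<sigma>::'a \<Rightarrow> 'a. restrict \<sigma> A"
  let ?F = "?r ` field_auts {}"
  have "?F \<subseteq> (\<Pi>\<^sub>E a\<in>A. (\<lambda>\<sigma>. \<sigma> a) ` {\<sigma>. field_hom \<sigma>})"
    using field_auts_hom by fastforce
  moreover have "finite (\<Pi>\<^sub>E a\<in>A. (\<lambda>\<sigma>. \<sigma> a) ` {\<sigma> :: 'a \<Rightarrow> 'a. field_hom \<sigma>})"
    using assms finite_orbit by (intro finite_PiE) auto
  ultimately have fin: "finite ?F" by (rule finite_subset)
  have "card ((\<lambda>\<sigma>. \<sigma> x) ` field_auts {}) \<le> card ?F" if x: "x \<in> fixed_field A" for x
  proof -
    have eq: "\<sigma> x = \<tau> x" if st: "\<sigma> \<in> field_auts {}" "\<tau> \<in> field_auts {}" "?r \<sigma> = ?r \<tau>" for \<sigma> \<tau>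
    proof -
      have inv: "inv_into UNIV \<tau> (\<tau> z) = z" "\<tau> (inv_into UNIV \<tau> z) = z" for z
        using field_auts_bij[OF st(2)] by (simp_all add: bij_is_inj bij_is_surj surj_f_inv_f)
      have "inv_into UNIV \<tau> \<circ> \<sigma> \<in> field_auts {}"
        by (intro field_auts_comp field_auts_inv st)
      moreover have "(inv_into UNIV \<tau> \<circ> \<sigma>) a = a" if "a \<in> A" for a
        using fun_cong[OF st(3), of a] that inv by simp
      ultimately have "inv_into UNIV \<tau> \<circ> \<sigma> \<in> field_auts A" by (simp add: field_auts_def)
      hence "inv_into UNIV \<tau> (\<sigma> x) = x" using fixed_fieldD[OF x] by fastforce
      thus ?thesis using inv by metis
    qed
    have "(\<lambda>\<sigma>. \<sigma> x) ` field_auts {} \<subseteq> (\<lambda>r. (inv_into (field_auts {}) ?r r) x) ` ?F"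
    proof safe
      fix \<sigma> :: "'a \<Rightarrow> 'a" assume s: "\<sigma> \<in> field_auts {}"
      hence m: "?r \<sigma> \<in> ?F" by blast
      have "inv_into (field_auts {}) ?r (?r \<sigma>) x = \<sigma> x"
        by (rule eq[OF inv_into_into[OF m] s f_inv_into_f[OF m]])
      thus "\<sigma> x \<in> (\<lambda>r. (inv_into (field_auts {}) ?r r) x) ` ?F"
        using m by (intro rev_image_eqI[OF m]) simp
    qed
    thus ?thesis using fin surj_card_le by blast
  qed
  thus ?thesis by blast
qed

text \<open>An automorphism permutes the orbit and therefore the linear factors.\<close>

lemma map_poly_prod_orbit:
  fixes x :: "'a::field_char_0"
  assumes s: "\<sigma> \<in> field_auts {}"
  defines "Y \<equiv> (\<lambda>\<sigma>. \<sigma> x) ` field_auts {}"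
  shows "map_poly \<sigma> (\<Prod>y\<in>Y. [:- y, 1:]) = (\<Prod>y\<in>Y. [:- y, 1:])"
proof -
  have inj: "inj \<sigma>" using field_auts_bij[OF s] by (rule bij_is_inj)
  have "\<sigma> ` Y = Y"
  proof safe
    fix y assume "y \<in> Y"
    then obtain \<tau> where t: "\<tau> \<in> field_auts {}" "y = \<tau> x" by (auto simp: Y_def)
    show "\<sigma> y \<in> Y" using field_auts_comp[OF s t(1)] t(2) by (auto simp: Y_def intro: rev_image_eqI)
    have "inv_into UNIV \<sigma> y \<in> Y"
      using field_auts_comp[OF field_auts_inv[OF s] t(1)] t(2) by (auto simp: Y_def intro: rev_image_eqI)
    moreover have "y = \<sigma> (inv_into UNIV \<sigma> y)"
      using field_auts_bij[OF s] by (simp add: bij_is_surj surj_f_inv_f)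
    ultimately show "y \<in> \<sigma> ` Y" by blast
  qed
  moreover have "(\<Prod>y\<in>\<sigma> ` Y. [:- y, 1:]) = (\<Prod>y\<in>Y. [:- \<sigma> y, 1:])"
    by (subst prod.reindex) (auto intro: inj_on_subset[OF inj])
  ultimately show ?thesis using field_hom_map_poly_prod_linear[OF field_auts_hom[OF s], of Y] by simp
qed

text \<open>The orbit polynomial \<open>P\<close> of x has rational coefficients and degree at most
  \<open>C\<close>. It divides a monic integer polynomial, so it is integral, and the bound on the
  conjugates bounds its coefficients; only finitely many such \<open>P\<close> exist. One embedding
  \<iota> suffices because the automorphisms supply the other conjugates.\<close>

theorem northcott:
  fixes A :: "'a::{alg_closed_field, field_char_0} set" and \<iota> :: "'a \<Rightarrow> complex"
  assumes alg: "\<And>x::'a. algebraic x" and A: "finite A" and \<iota>: "field_hom \<iota>"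
  shows "finite {x \<in> fixed_field A. algebraic_int x \<and> (\<forall>\<sigma>\<in>field_auts {}. cmod (\<iota> (\<sigma> x)) \<le> B)}"
    (is "finite ?N")
proof -
  obtain C where C: "\<forall>x\<in>fixed_field A. card ((\<lambda>\<sigma>. \<sigma> x) ` field_auts {}) \<le> C"
    using orbit_bounded[OF alg A] by blast
  define M where "M = \<lceil>(1 + max 0 B) ^ C\<rceil>"
  define S where "S = {p :: int poly. degree p \<le> C \<and> (\<forall>i. \<bar>coeff p i\<bar> \<le> M)}"
  have "?N \<subseteq> (\<Union>p\<in>S - {0}. {x. poly (map_poly of_int p) x = 0})"
  proof
    fix x assume "x \<in> ?N"
    hence x: "x \<in> fixed_field A" "algebraic_int x" "\<And>\<sigma>. \<sigma> \<in> field_auts {} \<Longrightarrow> cmod (\<iota> (\<sigma> x)) \<le> B"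
      by auto
    define Y where "Y = (\<lambda>\<sigma>. \<sigma> x) ` field_auts {}"
    define P where "P = (\<Prod>y\<in>Y. [:- y, 1:])"
    have finY: "finite Y"
      unfolding Y_def using finite_orbit[OF alg, of x, where 'b = 'a]
      by (rule rev_finite_subset) (auto dest: field_auts_hom)
    have xY: "x \<in> Y" using image_eqI[OF _ field_auts_id, of x "\<lambda>\<sigma>. \<sigma> x"] by (simp add: Y_def)
    have degP: "degree P = card Y"
      unfolding P_def by (subst degree_prod_eq_sum_degree) (auto)
    have monicP: "lead_coeff P = 1" unfolding P_def by (subst lead_coeff_prod) simp
    have Pinv: "map_poly \<sigma> P = P" if "\<sigma> \<in> field_auts {}" for \<sigma>
      unfolding P_def Y_def by (rule map_poly_prod_orbit[OF that])
    have rat: "coeff p i \<in> \<rat>" if p: "\<And>\<sigma>. \<sigma> \<in> field_auts {} \<Longrightarrow> map_poly \<sigma> p = p" for p :: "'a poly" and i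
    proof -
      have "\<sigma> (coeff p i) = coeff p i" if \<sigma>: "\<sigma> \<in> field_auts {}" for \<sigma>
        using arg_cong[OF p[OF \<sigma>], of "\<lambda>q. coeff q i"]
        by (simp add: coeff_map_poly field_hom_0[OF field_auts_hom[OF \<sigma>]])
      hence "coeff p i \<in> fixed_field {}" by (simp add: fixed_field_def)
      thus ?thesis by (rule fixed_field_empty[OF alg])
    qed
    obtain s where s: "lead_coeff s = 1" "\<forall>i. coeff s i \<in> \<int>" "poly s x = 0"
      using x(2) by (auto simp: algebraic_int.simps)
    have sinv: "map_poly \<sigma> s = s" if "\<sigma> \<in> field_auts {}" for \<sigma>
      using s(2) field_hom_Rats[OF field_auts_hom[OF that]] Ints_subset_Rats
      by (auto simp: poly_eq_iff coeff_map_poly field_hom_0[OF field_auts_hom[OF that]])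
    have "poly s y = 0" if "y \<in> Y" for y
    proof -
      obtain \<sigma> where t: "\<sigma> \<in> field_auts {}" "y = \<sigma> x" using \<open>y \<in> Y\<close> by (auto simp: Y_def)
      show ?thesis
        using field_hom_poly[OF field_auts_hom[OF t(1)], of s x] sinv[OF t(1)] t(2) s(3)
        by (simp add: field_hom_0[OF field_auts_hom[OF t(1)]])
    qed
    then obtain Q where Q: "s = P * Q"
      using prod_linear_dvd[OF finY] unfolding P_def by blast
    have "P \<noteq> 0" using monicP by auto
    \<comment> \<open>Cancelling \<open>P\<close> in s = P Q shows that the cofactor is invariant
      too, so both factors are rational, as Gauss's lemma requires.\<close>
    have Qinv: "map_poly \<sigma> Q = Q" if "\<sigma> \<in> field_auts {}" for \<sigma>
      using sinv[OF that] Pinv[OF that] \<open>P \<noteq> 0\<close>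
      by (simp add: Q field_hom_map_poly_mult[OF field_auts_hom[OF that]])
    have "lead_coeff Q = 1" using s(1) monicP by (simp add: Q lead_coeff_mult)
    hence int: "coeff P i \<in> \<int>" for i
      using s(2) unfolding Q by (intro monic_factor_Ints[of P Q] monicP allI rat Pinv Qinv) auto
    define p where "p = map_poly (\<lambda>c. THE k. c = of_int k) P"
    have "map_poly of_int p = P"
    proof (rule poly_eqI)
      fix i
      obtain k where k: "coeff P i = of_int k" using int by (auto elim: Ints_cases)
      have "coeff p i = k" by (simp add: p_def coeff_map_poly k)
      thus "coeff (map_poly of_int p) i = coeff P i" by (simp add: coeff_map_poly k)
    qed
    note pP = this
    have "p \<noteq> 0" using \<open>P \<noteq> 0\<close> pP by auto
    have "\<bar>coeff p i\<bar> \<le> M" for i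
    proof -
      have "complex_of_int (coeff p i) = \<iota> (of_int (coeff p i))"
        by (simp add: field_hom_of_int[OF \<iota>])
      also have "of_int (coeff p i) = coeff P i" by (simp flip: pP add: coeff_map_poly)
      also have "\<iota> (coeff P i) = coeff (map_poly \<iota> P) i"
        by (simp add: coeff_map_poly field_hom_0[OF \<iota>])
      also have "map_poly \<iota> P = (\<Prod>y\<in>Y. [:- \<iota> y, 1:])"
        unfolding P_def by (rule field_hom_map_poly_prod_linear[OF \<iota>])
      also have "cmod (coeff \<dots> i) \<le> (1 + max 0 B) ^ card Y"
        using x(3) by (intro norm_coeff_prod_linear_le) (auto simp: Y_def le_max_iff_disj)
      also have "\<dots> \<le> (1 + max 0 B) ^ C"
        using C x(1) by (intro power_increasing) (auto simp: Y_def)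
      also have "\<dots> \<le> of_int M" by (simp add: M_def)
      finally show ?thesis by (simp flip: of_int_abs)
    qed
    moreover have "degree p \<le> C"
      using degP C x(1) by (simp flip: pP add: Y_def degree_map_poly)
    moreover have "poly P x = 0" using xY finY by (auto simp: P_def poly_prod)
    ultimately show "x \<in> (\<Union>p\<in>S - {0}. {x. poly (map_poly of_int p) x = 0})"
      using \<open>p \<noteq> 0\<close> pP by (auto simp: S_def)
  qed
  moreover have "finite \<dots>"
  proof (intro finite_UN_I)
    show "finite (S - {0})" unfolding S_def using finite_bounded_int_polys by blast
    show "finite {x::'a. poly (map_poly of_int p) x = 0}" if "p \<in> S - {0}" for p
      using that by (intro poly_roots_finite) (simp add: map_poly_eq_0_iff)
  qed
  ultimately show ?thesis by (rule finite_subset)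
qed

section \<open>Infinitely divisible elements\<close>


text \<open>Splitting off one linear factor upstairs at a time shows that a polynomial with
  coefficients in the image has no roots outside the image.\<close>

lemma field_hom_algebraic_range:
  fixes \<phi> :: "'a::alg_closed_field \<Rightarrow> 'b::field"
  assumes "field_hom \<phi>" "p \<noteq> 0" "poly (map_poly \<phi> p) w = 0"
  shows "w \<in> range \<phi>"
  using assms(2,3)
proof (induction "degree p" arbitrary: p)
  case 0
  thus ?case
    by (auto elim!: degree_eq_zeroE simp: map_poly_pCons field_hom_0[OF assms(1)] field_hom_eq_0_iff[OF assms(1)]
        dest!: sym[of 0])
next
  case (Suc n)
  then obtain x where "poly p x = 0" using alg_closed_imp_poly_has_root[of p] by auto
  then obtain q where q: "p = [:- x, 1:] * q" by (auto simp: poly_eq_0_iff_dvd)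
  have "q \<noteq> 0" using Suc.prems q by auto
  hence "degree q = n" using Suc.hyps(2) unfolding q by (subst (asm) degree_mult_eq) auto
  have "map_poly \<phi> p = [:- \<phi> x, 1:] * map_poly \<phi> q"
    unfolding q field_hom_map_poly_mult[OF assms(1)]
    by (simp add: map_poly_pCons field_hom_0[OF assms(1)] field_hom_1[OF assms(1)] field_hom_uminus[OF assms(1)]
        del: mult_pCons_left)
  hence "w = \<phi> x \<or> poly (map_poly \<phi> q) w = 0" using Suc.prems(2) by (simp del: mult_pCons_left)
  thus ?case using Suc.hyps(1)[of q] \<open>degree q = n\<close> \<open>q \<noteq> 0\<close> by auto
qed

text \<open>The complex number exp(2 pi i / N) is a root of X^N - 1 and so lies in the image of an
  embedding; its preimage inherits the cyclic structure of the complex N-th roots of unity.\<close>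

lemma primitive_root_of_unity:
  assumes alg: "\<And>x::'a::{alg_closed_field, field_char_0}. algebraic x" and N: "N > 0"
  obtains g :: "'a::{alg_closed_field, field_char_0}" where "g ^ N = 1" "\<And>x. x ^ N = 1 \<Longrightarrow> \<exists>j. x = g ^ j" "\<And>j. g ^ j = 1 \<Longrightarrow> N dvd j"
proof -
  obtain \<iota> :: "'a \<Rightarrow> complex" where \<iota>: "field_hom \<iota>" using exists_complex_embedding[OF alg] by blast
  have inj: "\<iota> x = \<iota> y \<longleftrightarrow> x = y" for x y
    using field_hom_inj[OF \<iota>] by (simp add: inj_eq)
  let ?c = "\<lambda>k. cis (2 * pi * real k / real N)"
  have bij: "bij_betw ?c {..<N} {z. z ^ N = 1}" by (rule bij_betw_roots_unity[OF N])
  have pow: "?c 1 ^ k = ?c k" for k by (simp add: DeMoivre mult_ac)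
  have "?c 1 ^ N = 1" unfolding pow using N by simp
  let ?p = "monom 1 N - 1 :: 'a poly"
  have "map_poly \<iota> ?p = monom 1 N - 1"
    by (simp add: poly_eq_iff coeff_map_poly field_hom_0[OF \<iota>] field_hom_diff[OF \<iota>] field_hom_1[OF \<iota>] coeff_1)
  moreover have "coeff ?p N = 1" using N by (simp add: coeff_1)
  hence "?p \<noteq> 0" by (metis coeff_0 zero_neq_one)
  ultimately have "?c 1 \<in> range \<iota>"
    using \<open>?c 1 ^ N = 1\<close> by (intro field_hom_algebraic_range[OF \<iota>, of ?p]) (simp_all add: poly_monom)
  then obtain g where g: "?c 1 = \<iota> g" by blast
  hence gk: "\<iota> (g ^ k) = ?c k" for k using pow by (simp only: field_hom_power[OF \<iota>])
  show thesis
  proof (rule that)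
    have "\<iota> (g ^ N) = \<iota> 1"
      using \<open>?c 1 ^ N = 1\<close> by (simp only: field_hom_power[OF \<iota>] field_hom_1[OF \<iota>] flip: g)
    thus gN: "g ^ N = 1" by (simp only: inj)
    show "\<exists>j. x = g ^ j" if "x ^ N = 1" for x
    proof -
      have "\<iota> x ^ N = 1" using that by (simp flip: field_hom_power[OF \<iota>] add: field_hom_1[OF \<iota>])
      then obtain k where "\<iota> x = ?c k" using bij_betw_imp_surj_on[OF bij] by blast
      hence "\<iota> x = \<iota> (g ^ k)" by (simp only: gk)
      thus ?thesis using inj by blast
    qed
    show "N dvd j" if "g ^ j = 1" for j
    proof -
      have "g ^ j = g ^ (N * (j div N) + j mod N)" by simp
      also have "\<dots> = g ^ (j mod N)" by (simp only: power_add power_mult gN) simp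
      finally have "g ^ (j mod N) = g ^ 0" using that by simp
      hence "?c (j mod N) = ?c 0" by (simp only: flip: gk)
      hence "j mod N = 0"
        using bij_betw_imp_inj_on[OF bij] N by (subst (asm) inj_on_eq_iff[of ?c "{..<N}"]) auto
      thus ?thesis by auto
    qed
  qed
qed

text \<open>With l the leading coefficient of an equation of degree n for c, multiplying by l^(j n -
  1) gives a monic equation for l^j c. The point is that \<open>m\<close> is independent of j: if
  x^j = c, then (m x)^j is integral, so one denominator serves the roots of c of every
  order.\<close>

lemma algebraic_int_power_denominator:
  fixes c :: "'a::field_char_0"
  assumes "algebraic c"
  shows "\<exists>m::int. m \<noteq> 0 \<and> (\<forall>j\<ge>1. algebraic_int (of_int m ^ j * c))"
proof -
  obtain p :: "int poly" where p: "p \<noteq> 0" "poly (map_poly of_int p) c = 0"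
    using assms by (erule algebraicE')
  define l where "l = lead_coeff p"
  define n where "n = degree p"
  have sum0: "(\<Sum>i\<le>n. of_int (coeff p i) * c ^ i) = 0"
    using p(2) by (simp add: poly_altdef coeff_map_poly degree_map_poly n_def)
  have "n \<noteq> 0"
  proof
    assume "n = 0"
    hence "lead_coeff p = 0" using sum0 by (simp add: n_def)
    thus False using p(1) by simp
  qed
  have "algebraic_int (of_int l ^ j * c)" if j: "j \<ge> 1" for j
  proof
    define r :: "'a poly" where "r = (\<Sum>i<n. monom (of_int l ^ (j * (n - i) - 1) * of_int (coeff p i)) i)"
    let ?q = "monom 1 n + r"
    have coeff_r: "coeff r i = (if i < n then of_int l ^ (j * (n - i) - 1) * of_int (coeff p i) else 0)" for i
      by (simp add: r_def coeff_sum)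
    have "degree ?q = n"
      using \<open>n \<noteq> 0\<close> by (intro antisym degree_le le_degree) (auto simp: coeff_r)
    thus "lead_coeff ?q = 1" by (simp add: coeff_r)
    show "\<forall>i. coeff ?q i \<in> \<int>" by (auto simp: coeff_r)
    let ?y = "of_int l ^ j * c"
    have 1: "of_int l ^ (j * (n - i) - 1) * of_int (coeff p i) * ?y ^ i
        = of_int l ^ (j * n - 1) * (of_int (coeff p i) * c ^ i)" if "i < n" for i
    proof -
      have "j * (n - i) \<ge> 1" using that j by simp
      moreover have "j * (n - i) + j * i = j * n" using that by (simp flip: distrib_left)
      ultimately have "j * (n - i) - 1 + j * i = j * n - 1" by simp
      hence "(of_int l :: 'a) ^ (j * (n - i) - 1) * (of_int l ^ j) ^ i = of_int l ^ (j * n - 1)"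
        by (simp flip: power_mult power_add)
      thus ?thesis by (simp add: power_mult_distrib mult_ac)
    qed
    have "j * n = Suc (j * n - 1)" using j \<open>n \<noteq> 0\<close> by simp
    hence "(of_int l :: 'a) ^ (j * n) = of_int l ^ (j * n - 1) * of_int l"
      by (metis power_Suc2)
    hence 2: "?y ^ n = of_int l ^ (j * n - 1) * (of_int (coeff p n) * c ^ n)"
      by (simp add: power_mult_distrib l_def n_def flip: power_mult)
    have "poly ?q ?y = ?y ^ n + (\<Sum>i<n. of_int l ^ (j * (n - i) - 1) * of_int (coeff p i) * ?y ^ i)"
      by (simp add: r_def poly_sum poly_monom)
    also have "(\<Sum>i<n. of_int l ^ (j * (n - i) - 1) * of_int (coeff p i) * ?y ^ i)
        = (\<Sum>i<n. of_int l ^ (j * n - 1) * (of_int (coeff p i) * c ^ i))"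
      by (intro sum.cong refl 1) simp
    also have "?y ^ n + \<dots> = of_int l ^ (j * n - 1) * (\<Sum>i\<le>n. of_int (coeff p i) * c ^ i)"
      unfolding 2 by (simp add: sum_distrib_left distrib_left flip: lessThan_Suc_atMost)
    finally have "poly ?q ?y = of_int l ^ (j * n - 1) * (\<Sum>i\<le>n. of_int (coeff p i) * c ^ i)" .
    thus "poly ?q ?y = 0" by (simp add: sum0)
  qed
  thus ?thesis using p(1) by (intro exI[of _ l]) (auto simp: l_def)
qed

section \<open>Divisible elements over the base attached to a finite set\<close>

context
  fixes A :: "'a::{alg_closed_field, field_char_0} set"
  assumes alg: "\<And>x::'a. algebraic x" and A: "finite A"
begin

text \<open>Roots of unity are algebraic integers whose conjugates have modulus 1, so Northcott
  leaves finitely many in the base; \<open>w\<close> is the product of their individual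
  exponents.\<close>

lemma root_of_unity_exponent:
  "\<exists>w\<ge>1. \<forall>\<zeta>\<in>fixed_field A. root_of_unity \<zeta> \<longrightarrow> \<zeta> ^ w = 1"
proof -
  obtain \<iota> :: "'a \<Rightarrow> complex" where \<iota>: "field_hom \<iota>" using exists_complex_embedding[OF alg] by blast
  let ?Z = "{\<zeta> \<in> fixed_field A. root_of_unity \<zeta>}"
  have "?Z \<subseteq> {x \<in> fixed_field A. algebraic_int x \<and> (\<forall>\<sigma>\<in>field_auts {}. cmod (\<iota> (\<sigma> x)) \<le> 1)}"
  proof safe
    fix \<zeta> :: 'a assume "root_of_unity \<zeta>"
    then obtain n where n: "n \<ge> 1" "\<zeta> ^ n = 1" by (auto simp: root_of_unity_def)
    show "algebraic_int \<zeta>"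
      by (rule algebraic_int_root[of 1 "monom 1 n"]) (use n in \<open>auto simp: poly_monom degree_monom_eq\<close>)
    fix \<sigma> :: "'a \<Rightarrow> 'a" assume s: "\<sigma> \<in> field_auts {}"
    have "\<iota> (\<sigma> \<zeta>) ^ n = 1"
      using n(2) by (simp add: field_hom_1[OF field_auts_hom[OF s]] field_hom_1[OF \<iota>]
          flip: field_hom_power[OF field_auts_hom[OF s]] field_hom_power[OF \<iota>])
    hence "cmod (\<iota> (\<sigma> \<zeta>)) = 1" using n(1) power_eq_1_iff[of _ n] by auto
    thus "cmod (\<iota> (\<sigma> \<zeta>)) \<le> 1" by simp
  qed
  hence fin: "finite ?Z" using northcott[OF alg A \<iota>] by (rule finite_subset)
  obtain n where n: "\<And>\<zeta>. \<zeta> \<in> ?Z \<Longrightarrow> n \<zeta> \<ge> (1::nat) \<and> \<zeta> ^ n \<zeta> = 1"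
  proof -
    have "\<exists>n. \<zeta> \<in> ?Z \<longrightarrow> n \<ge> (1::nat) \<and> \<zeta> ^ n = 1" for \<zeta>
      by (auto simp: root_of_unity_def)
    thus thesis using that by metis
  qed
  have "\<zeta> ^ prod n ?Z = 1" if "\<zeta> \<in> ?Z" for \<zeta>
  proof -
    have "n \<zeta> dvd prod n ?Z" using fin that by (rule dvd_prodI)
    thus ?thesis using n[OF that] by (auto simp: power_mult elim!: dvdE)
  qed
  moreover have "prod n ?Z \<ge> 1" using n by (intro prod_ge_1) auto
  ultimately show ?thesis by blast
qed

text \<open>The roots of c in the base share a denominator \<open>m\<close> and have conjugates
  bounded in terms of those of c. By Northcott they take finitely many values, so one value is a
  root of two different orders.\<close>

lemma unbounded_power_root_of_unity:
  assumes c: "c \<noteq> 0" and div: "\<And>j. \<exists>n>j. \<exists>x\<in>fixed_field A. x ^ n = c"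
  shows "root_of_unity c"
proof -
  obtain \<iota> :: "'a \<Rightarrow> complex" where \<iota>: "field_hom \<iota>" using exists_complex_embedding[OF alg] by blast
  obtain m :: int where m: "m \<noteq> 0" "\<forall>j\<ge>1. algebraic_int (of_int m ^ j * c)"
    using algebraic_int_power_denominator[OF alg[of c]] by blast
  define H where "H = (\<lambda>\<phi>. \<phi> c) ` {\<phi> :: 'a \<Rightarrow> complex. field_hom \<phi>}"
  have "finite H" unfolding H_def by (rule finite_orbit[OF alg])
  \<comment> \<open>If x^n = c and an embedded x has modulus above 1, that modulus is at most its
    n-th power, the modulus of the embedded c; the maximum with 1 covers the other case.\<close>
  define B where "B = max 1 (Max (cmod ` H))"
  have B: "cmod (\<phi> x) \<le> B" if "field_hom \<phi>" "x ^ n = c" "n \<ge> 1" for \<phi> :: "'a \<Rightarrow> complex" and x n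
  proof (rule ccontr)
    assume "\<not> cmod (\<phi> x) \<le> B"
    hence gt: "cmod (\<phi> x) > 1" "cmod (\<phi> x) > Max (cmod ` H)" by (auto simp: B_def)
    have "\<phi> c \<in> H" using that(1) by (auto simp: H_def)
    have "cmod (\<phi> x) \<le> cmod (\<phi> x) ^ n" using gt(1) that(3) by (intro self_le_power) auto
    also have "\<dots> = cmod (\<phi> c)"
      by (simp flip: that(2) add: field_hom_power[OF that(1)] norm_power)
    also have "\<dots> \<le> Max (cmod ` H)" using \<open>finite H\<close> \<open>\<phi> c \<in> H\<close> by (intro Max_ge) auto
    finally show False using gt(2) by simp
  qed
  let ?W = "{x \<in> fixed_field A. algebraic_int x \<and> (\<forall>\<sigma>\<in>field_auts {}. cmod (\<iota> (\<sigma> x)) \<le> \<bar>m\<bar> * B)}"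
  obtain n x where nx: "\<And>j. n j > j" "\<And>j. x j \<in> fixed_field A" "\<And>j. x j ^ n j = c"
    using div by metis
  have n1: "n j \<ge> 1" for j using nx(1)[of j] by simp
  have "of_int m * x j \<in> ?W" for j
  proof (intro CollectI conjI ballI)
    show "of_int m * x j \<in> fixed_field A" by (intro fixed_field_mult fixed_field_of_int nx)
    show "algebraic_int (of_int m * x j)"
      by (rule algebraic_int_root[of "of_int m ^ n j * c" "monom 1 (n j)"])
        (use m(2) n1[of j] in \<open>auto simp: poly_monom power_mult_distrib nx(3) degree_monom_eq\<close>)
    fix \<sigma> :: "'a \<Rightarrow> 'a" assume s: "\<sigma> \<in> field_auts {}"
    have "\<iota> (\<sigma> (of_int m * x j)) = of_int m * \<iota> (\<sigma> (x j))"
      by (simp add: field_hom_mult[OF field_auts_hom[OF s]] field_hom_mult[OF \<iota>]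
          field_hom_of_int[OF field_auts_hom[OF s]] field_hom_of_int[OF \<iota>])
    moreover have "cmod (\<iota> (\<sigma> (x j))) \<le> B"
      using B[OF field_hom_comp[OF \<iota> field_auts_hom[OF s]] nx(3) n1] by simp
    ultimately show "cmod (\<iota> (\<sigma> (of_int m * x j))) \<le> \<bar>m\<bar> * B"
      by (simp add: norm_mult mult_left_mono)
  qed
  hence "range (\<lambda>j. of_int m * x j) \<subseteq> ?W" by blast
  hence "finite (range (\<lambda>j. of_int m * x j))"
    using northcott[OF alg A \<iota>] by (rule finite_subset)
  then obtain j where "infinite {i \<in> UNIV. of_int m * x i = of_int m * x j}"
    using pigeonhole_infinite[of "UNIV :: nat set" "\<lambda>j. of_int m * x j"] by blast
  \<comment> \<open>One value occurs at infinitely many indices; going past \<open>n j\<close> gives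
    n i > i > n j, so the two exponents differ.\<close>
  then obtain i where i: "i > n j" "x i = x j"
    using m(1) by (auto simp: infinite_nat_iff_unbounded)
  have lt: "n j < n i" using i(1) nx(1)[of i] by simp
  have "x j \<noteq> 0" using nx(3)[of j] c n1[of j] by (auto simp: power_0_left)
  have "x j ^ n j * x j ^ (n i - n j) = x j ^ n i"
    using lt by (simp flip: power_add)
  hence 1: "x j ^ (n i - n j) = 1" using nx(3)[of i] nx(3)[of j] i(2) c by simp
  have "c ^ (n i - n j) = (x j ^ (n i - n j)) ^ n j"
    by (simp flip: nx(3)[of j] power_mult add: mult.commute)
  hence "c ^ (n i - n j) = 1" by (simp add: 1)
  thus ?thesis using lt unfolding root_of_unity_def by (intro exI[of _ "n i - n j"]) auto
qed

text \<open>
  If \<open>\<tau>\<close> acts on the \<open>N\<close>-th roots of unity as the \<open>t\<close>-th power, then \<open>\<tau> y / y ^ t\<close> is fixed by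
  everything that commutes with \<open>\<tau>\<close> at \<open>y\<close>.
\<close>

lemma commuting_power_root_in_fixed_field:
  assumes \<tau>: "\<tau> \<in> field_auts A" and b: "b \<in> fixed_field A" "b \<noteq> 0"
    and y: "y ^ N = b" "\<And>\<sigma>. \<sigma> \<in> field_auts A \<Longrightarrow> \<sigma> (\<tau> y) = \<tau> (\<sigma> y)" and N: "N > 0"
    and t: "\<And>x. x ^ N = 1 \<Longrightarrow> \<tau> x = x ^ t"
  shows "\<tau> y / y ^ t \<in> fixed_field A"
  unfolding fixed_field_def
proof safe
  fix \<sigma> assume s: "\<sigma> \<in> field_auts A"
  have hs: "field_hom \<sigma>" and ht: "field_hom \<tau>" using s \<tau> by (auto dest: field_auts_hom)
  have "y \<noteq> 0" using y(1) b(2) N by auto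
  define \<zeta> where "\<zeta> = \<sigma> y / y"
  have sy: "\<sigma> y = \<zeta> * y" using \<open>y \<noteq> 0\<close> by (simp add: \<zeta>_def)
  have "\<zeta> ^ N = \<sigma> (y ^ N) / y ^ N" by (simp add: \<zeta>_def power_divide field_hom_power[OF hs])
  also have "\<dots> = 1" using fixed_fieldD[OF b(1) s] b(2) by (simp add: y(1))
  finally have z: "\<zeta> ^ N = 1" .
  hence "\<zeta> \<noteq> 0" using N by (auto simp: power_0_left)
  have "\<sigma> (\<tau> y / y ^ t) = \<tau> (\<zeta> * y) / (\<zeta> * y) ^ t"
    by (simp add: field_hom_divide[OF hs] field_hom_power[OF hs] y(2)[OF s] sy)
  also have "\<dots> = \<tau> y / y ^ t"
    using \<open>\<zeta> \<noteq> 0\<close> by (simp add: field_hom_mult[OF ht] t[OF z] power_mult_distrib)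
  finally show "\<sigma> (\<tau> y / y ^ t) = \<tau> y / y ^ t" .
qed

theorem commuting_divisible_root_of_unity:
  fixes p :: nat
  assumes p: "normalization_semidom_class.prime p" and b: "b \<in> fixed_field A" "b \<noteq> 0"
    and div: "\<And>k. \<exists>y. y ^ (p ^ k) = b \<and>
      (\<forall>\<sigma>\<in>field_auts A. \<forall>\<tau>\<in>field_auts A. \<sigma> (\<tau> y) = \<tau> (\<sigma> y))"
  shows "root_of_unity b"
proof -
  have p1: "p > 1" using p by (rule prime_gt_1_nat)
  obtain w where w: "w \<ge> 1" "\<And>\<zeta>. \<zeta> \<in> fixed_field A \<Longrightarrow> root_of_unity \<zeta> \<Longrightarrow> \<zeta> ^ w = 1"
    using root_of_unity_exponent by blast
  have "p ^ w > 0" using p1 by simp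
  obtain \<zeta> :: 'a where z: "\<zeta> ^ (p ^ w) = 1" "\<And>j. \<zeta> ^ j = 1 \<Longrightarrow> p ^ w dvd j"
    by (rule primitive_root_of_unity[OF alg \<open>p ^ w > 0\<close>]) blast
  \<comment> \<open>In the base, \<zeta> would be killed by \<open>w\<close>, so its order p^w would
    divide w; but p^w exceeds w.\<close>
  have "\<zeta> \<notin> fixed_field A"
  proof
    assume "\<zeta> \<in> fixed_field A"
    moreover have "root_of_unity \<zeta>" using z(1) p1 by (auto simp: root_of_unity_def intro!: exI[of _ "p ^ w"])
    ultimately have "p ^ w dvd w" using w(2) z(2) by blast
    hence "p ^ w \<le> w" using w(1) by (auto intro: dvd_imp_le)
    thus False using power_gt_expt[of p w] p1 by simp
  qed
  then obtain \<tau> where \<tau>: "\<tau> \<in> field_auts A" "\<tau> \<zeta> \<noteq> \<zeta>" by (auto simp: fixed_field_def)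
  have ht: "field_hom \<tau>" by (rule field_auts_hom[OF \<tau>(1)])
  have "\<exists>n>j. \<exists>x\<in>fixed_field A. x ^ n = b ^ w" for j
  proof -
    \<comment> \<open>The summand \<open>w\<close> makes \<zeta> an N-th root of unity, so that the
      exponent of \<tau> on these roots also governs \<zeta>. The loss later on is p^e with e < w,
      which leaves more than \<open>j\<close> levels.\<close>
    define k where "k = w + j"
    define N where "N = p ^ k"
    have N: "N > 0" using p1 by (simp add: N_def)
    obtain g :: 'a where g: "g ^ N = 1" "\<And>x. x ^ N = 1 \<Longrightarrow> \<exists>j. x = g ^ j"
      by (rule primitive_root_of_unity[OF alg N]) blast
    have "\<tau> g ^ N = 1" using g(1) by (simp flip: field_hom_power[OF ht] add: field_hom_1[OF ht])
    then obtain t' where "\<tau> g = g ^ t'" using g(2) by blast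
    \<comment> \<open>Adding N does not change the action on N-th roots of unity and makes the
      exponent positive, so that it is \<open>Suc s\<close>.\<close>
    define s where "s = t' + N - 1"
    have "\<tau> g = g ^ Suc s"
      using N \<open>\<tau> g = g ^ t'\<close> g(1) by (simp add: s_def power_add del: power_Suc)
    have t: "\<tau> x = x ^ Suc s" if "x ^ N = 1" for x
    proof -
      obtain j where "x = g ^ j" using g(2) \<open>x ^ N = 1\<close> by blast
      thus ?thesis using \<open>\<tau> g = g ^ Suc s\<close>
        by (simp only: field_hom_power[OF ht] flip: power_mult) (simp only: mult.commute)
    qed
    obtain y where y: "y ^ N = b" "\<And>\<sigma>. \<sigma> \<in> field_auts A \<Longrightarrow> \<sigma> (\<tau> y) = \<tau> (\<sigma> y)"
      using div[of k] \<tau>(1) unfolding N_def by blast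
    define z where "z = \<tau> y / y ^ Suc s"
    have zE: "z \<in> fixed_field A"
      unfolding z_def by (rule commuting_power_root_in_fixed_field[OF \<tau>(1) b y N t])
    have "z ^ N = \<tau> (y ^ N) / (y ^ N) ^ Suc s"
      by (simp add: z_def power_divide field_hom_power[OF ht] mult.commute flip: power_mult del: power_Suc)
    also have "\<dots> = 1 / b ^ s"
      using b(2) fixed_fieldD[OF b(1) \<tau>(1)] by (simp add: y(1))
    finally have zN: "z ^ N = 1 / b ^ s" .
    have "z \<noteq> 0" using zN b(2) N by (auto simp: power_0_left)
    have nd: "\<not> p ^ w dvd s"
    proof
      assume "p ^ w dvd s"
      hence "\<zeta> ^ s = 1" using z(1) by (auto simp: power_mult elim!: dvdE)
      moreover have "\<zeta> ^ N = 1" using z(1) by (simp add: N_def k_def power_add power_mult)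
      ultimately show False using t[of \<zeta>] \<tau>(2) by simp
    qed
    hence "s \<noteq> 0" by (metis dvd_0_right)
    then obtain i l where il: "s * i = N * l + gcd s N" using bezout_nat by blast
    \<comment> \<open>Both b^s = 1 / z^N and b^N are N-th powers of elements of the base; the Bezout
      relation combines them into an N-th root of b^gcd(s, N).\<close>
    define u where "u = 1 / (z ^ i * b ^ l)"
    have uE: "u \<in> fixed_field A"
      using fixed_field_of_int[of 1 A] by (auto simp: u_def intro!: fixed_field_divide fixed_field_mult fixed_field_power zE b)
    have "u ^ N = 1 / ((z ^ N) ^ i * b ^ (N * l))"
      by (simp add: u_def power_divide power_mult_distrib mult.commute flip: power_mult)
    also have "\<dots> = b ^ (s * i) / b ^ (N * l)" by (simp add: zN power_divide power_mult)
    also have "\<dots> = b ^ gcd s N" using b(2) by (simp add: il power_add)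
    finally have uN: "u ^ N = b ^ gcd s N" .
    obtain e where e: "gcd s N = p ^ e" "e \<le> k"
      using divides_primepow_nat[OF p, of "gcd s N" k] by (auto simp: N_def)
    have "e < w"
    proof (rule ccontr)
      assume "\<not> e < w"
      hence "p ^ w dvd gcd s N" unfolding e(1) by (intro le_imp_power_dvd) simp
      thus False using nd by simp
    qed
    define n where "n = p ^ (k - e)"
    have "k - e < n" unfolding n_def using p1 by (intro power_gt_expt) simp
    hence "j < n" using \<open>e < w\<close> by (simp add: k_def)
    have "N = p ^ e * n" using e(2) by (simp add: N_def n_def flip: power_add)
    have uN': "u ^ (p ^ e * n) = b ^ (p ^ e)"
      using uN unfolding e(1) by (simp only: \<open>N = p ^ e * n\<close>)
    have "u \<noteq> 0" using \<open>z \<noteq> 0\<close> b(2) by (simp add: u_def)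
    \<comment> \<open>So b and u^n differ by a root of unity of the base, which disappears in the
      w-th power: b^w is an n-th power.\<close>
    have "(b / u ^ n) ^ (p ^ e) = 1"
      using uN' b(2) by (simp add: power_divide mult.commute flip: power_mult)
    hence "root_of_unity (b / u ^ n)"
      using p1 by (auto simp: root_of_unity_def intro!: exI[of _ "p ^ e"])
    hence "(b / u ^ n) ^ w = 1"
      by (intro w fixed_field_divide fixed_field_power b uE)
    hence "(u ^ w) ^ n = b ^ w"
      using \<open>u \<noteq> 0\<close> by (simp add: power_divide mult.commute flip: power_mult)
    thus ?thesis using \<open>j < n\<close> fixed_field_power[OF uE, of w] by blast
  qed
  hence "root_of_unity (b ^ w)" using b(2) by (intro unbounded_power_root_of_unity) auto
  then obtain n where "n \<ge> 1" "(b ^ w) ^ n = 1" by (auto simp: root_of_unity_def)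
  thus ?thesis
    using w(1) unfolding root_of_unity_def
    by (intro exI[of _ "w * n"]) (auto simp: power_mult)
qed

end

section \<open>Backward orbits of a periodic critical point\<close>


lemma root_of_unity_powerD: "root_of_unity (x ^ n) \<Longrightarrow> n \<ge> 1 \<Longrightarrow> root_of_unity x"
  unfolding root_of_unity_def
proof (elim exE conjE)
  fix k assume "n \<ge> 1" "k \<ge> 1" "(x ^ n) ^ k = 1"
  thus "\<exists>n\<ge>1. x ^ n = 1" by (intro exI[of _ "n * k"]) (simp add: power_mult)
qed

text \<open>The iterate is a monic polynomial of positive degree, and subtracting a constant keeps
  it so. A multiset of roots is used because evaluation of the product must respect
  multiplicities.\<close>

lemma iterate_minus_factorization:
  fixes c :: "'a::alg_closed_field"
  assumes "d \<ge> 1"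
  shows "\<exists>M. \<forall>x. ((\<lambda>x. x ^ d + c) ^^ n) x - \<beta> = (\<Prod>\<eta>\<in>#M. (x - \<eta>))"
proof -
  let ?g = "\<lambda>x. x ^ d + c"
  have "\<exists>q. lead_coeff q = 1 \<and> degree q > 0 \<and> (\<forall>x. poly q x = (?g ^^ n) x)"
  proof (induction n)
    case 0
    show ?case by (intro exI[of _ "[:0, 1:]"]) simp
  next
    case (Suc n)
    then obtain q where q: "lead_coeff q = 1" "degree q > 0" "\<And>x. poly q x = (?g ^^ n) x" by blast
    have deg: "degree (q ^ d) = d * degree q" using q(1) by (subst degree_power_eq) auto
    hence lt: "degree [:c:] < degree (q ^ d)" using q(2) assms by simp
    show ?case
    proof (intro exI[of _ "q ^ d + [:c:]"] conjI allI)
      show "lead_coeff (q ^ d + [:c:]) = 1"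
        using lt q(1) by (simp add: degree_add_eq_left coeff_eq_0 lead_coeff_power)
      show "degree (q ^ d + [:c:]) > 0" using lt by (simp add: degree_add_eq_left)
    qed (simp add: q(3))
  qed
  then obtain q where q: "lead_coeff q = 1" "degree q > 0" "\<And>x. poly q x = (?g ^^ n) x" by blast
  let ?q = "q - [:\<beta>:]"
  have "degree ?q = degree q" using q(2) by (simp add: degree_add_eq_left flip: add_uminus_conv_diff)
  hence lead: "lead_coeff ?q = 1" using q by (simp add: coeff_eq_0)
  hence "?q \<noteq> 0" by auto
  then obtain M where "?q = smult (lead_coeff ?q) (\<Prod>\<eta>\<in>#M. [:-\<eta>, 1:])"
    using alg_closed_imp_factorization by blast
  hence *: "?q = (\<Prod>\<eta>\<in>#M. [:-\<eta>, 1:])" by (simp only: lead smult_1_left)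
  have "poly (\<Prod>\<eta>\<in>#M. [:-\<eta>, 1:]) x = (\<Prod>\<eta>\<in>#M. (x - \<eta>))" for x
    by (induction M) (simp_all del: mult_pCons_left)
  hence "(?g ^^ n) x - \<beta> = (\<Prod>\<eta>\<in>#M. (x - \<eta>))" for x
    using arg_cong[OF *, of "\<lambda>p. poly p x"] q(3)[of x] by simp
  thus ?thesis by blast
qed

text \<open>
  Let \<open>0\<close> have period \<open>m + 1\<close>. If \<open>\<eta>\<close> runs over the roots of \<open>g^m(x) = \<beta>\<close> and \<open>g \<gamma> = \<eta>\<close>, then
  evaluating \<open>g^m(x) - \<beta>\<close> at \<open>c = g 0\<close> gives \<open>- \<beta> = \<Prod>(c - \<eta>) = \<Prod>(- \<gamma> ^ d)\<close>. Hence, up to sign, every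
  point of the tree is a \<open>d\<close>-th power of a product of points of the tree, and this can be iterated.
\<close>

lemma periodic_tree_divisible:
  fixes c :: "'a::alg_closed_field" and d :: nat
  defines "g \<equiv> \<lambda>x. x ^ d + c"
  assumes d: "d \<ge> 1" and per: "(g ^^ Suc m) 0 = 0"
    and T: "\<And>x. g x \<in> T \<Longrightarrow> x \<in> T"
    and M: "T \<subseteq> M" "1 \<in> M" "\<And>x y. x \<in> M \<Longrightarrow> y \<in> M \<Longrightarrow> x * y \<in> M"
    and \<beta>: "\<beta> \<in> T"
  shows "\<exists>w\<in>M. \<beta> ^ 2 = w ^ (2 * d ^ k)"
  using \<beta>
proof (induction k arbitrary: \<beta>)
  case 0
  thus ?case using M(1) by auto
next
  case (Suc k)
  have Tm: "x \<in> T" if "(g ^^ n) x \<in> T" for x n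
    using that by (induction n arbitrary: x) (auto simp: funpow_swap1 dest: T)
  obtain R where R: "\<And>x. (g ^^ m) x - \<beta> = (\<Prod>\<eta>\<in>#R. (x - \<eta>))"
    using iterate_minus_factorization[OF d, of m c \<beta>] unfolding g_def by blast
  have "\<exists>w\<in>M. (c - \<eta>) ^ 2 = w ^ (2 * d ^ Suc k)" if \<eta>: "\<eta> \<in># R" for \<eta>
  proof -
    have "(g ^^ m) \<eta> - \<beta> = 0" unfolding R using \<eta> by (force simp: prod_mset_zero_iff)
    hence "\<eta> \<in> T" using Tm[of m \<eta>] Suc.prems by simp
    obtain \<gamma> where \<gamma>: "\<gamma> ^ d = \<eta> - c" using nth_root_exists[of d "\<eta> - c"] d by auto
    hence "g \<gamma> = \<eta>" by (simp add: g_def)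
    hence "\<gamma> \<in> T" using T[of \<gamma>] \<open>\<eta> \<in> T\<close> by simp
    then obtain w where w: "w \<in> M" "\<gamma> ^ 2 = w ^ (2 * d ^ k)" using Suc.IH by blast
    \<comment> \<open>Here c - \<eta> = -\<gamma>^d; comparing squares drops the sign, whence the
      factor 2 in all exponents.\<close>
    have "(c - \<eta>) ^ 2 = (\<gamma> ^ d) ^ 2" unfolding \<gamma> by (rule power2_commute)
    also have "\<dots> = (\<gamma> ^ 2) ^ d" by (simp add: mult.commute flip: power_mult)
    also have "\<dots> = w ^ (2 * d ^ Suc k)" unfolding w(2) by (simp add: mult_ac flip: power_mult)
    finally show ?thesis using w(1) by blast
  qed
  hence "\<exists>w\<in>M. (\<Prod>\<eta>\<in>#R. (c - \<eta>)) ^ 2 = w ^ (2 * d ^ Suc k)"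
  proof (induction R)
    case empty
    show ?case using M(2) by (intro bexI[of _ 1]) simp_all
  next
    case (add \<eta> R)
    obtain v where v: "v \<in> M" "(c - \<eta>) ^ 2 = v ^ (2 * d ^ Suc k)" using add.prems[of \<eta>] by auto
    have "\<exists>w\<in>M. (\<Prod>\<eta>\<in>#R. (c - \<eta>)) ^ 2 = w ^ (2 * d ^ Suc k)"
      by (rule add.IH) (rule add.prems, simp)
    then obtain w where w: "w \<in> M" "(\<Prod>\<eta>\<in>#R. (c - \<eta>)) ^ 2 = w ^ (2 * d ^ Suc k)" by blast
    show ?case using M(3)[OF v(1) w(1)] v(2) w(2)
      by (intro bexI[of _ "v * w"]) (simp_all only: prod_mset.add_mset image_mset_add_mset power_mult_distrib)
  qed
  moreover have "g 0 = c" using d by (simp add: g_def power_0_left)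
  hence "(g ^^ m) c = 0" using per by (simp only: funpow_Suc_right o_apply)
  hence "(\<Prod>\<eta>\<in>#R. (c - \<eta>)) ^ 2 = \<beta> ^ 2" using R[of c, symmetric] by simp
  ultimately show ?case by simp
qed

text \<open>On the unit circle cnj z = 1/z, so the equation of the translated circle becomes a
  quadratic in z with leading coefficient -cnj w.\<close>

lemma finite_unit_circle_Int_translate:
  assumes "w \<noteq> 0"
  shows "finite {z. cmod z = 1 \<and> cmod (z - w) = 1}"
proof (rule finite_subset)
  let ?p = "[:- w, w * cnj w, - cnj w:]"
  show "{z. cmod z = 1 \<and> cmod (z - w) = 1} \<subseteq> {z. poly ?p z = 0}"
  proof safe
    fix z assume "cmod z = 1" "cmod (z - w) = 1"
    hence 1: "z * cnj z = 1" and "(z - w) * cnj (z - w) = 1"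
      by (simp_all only: complex_norm_square[symmetric]) simp_all
    hence 2: "w * cnj w - w * cnj z - z * cnj w = 0" by (simp add: algebra_simps)
    have "z * (w * cnj w) - w * (z * cnj z) - z * z * cnj w = z * (w * cnj w - w * cnj z - z * cnj w)"
      by (simp add: algebra_simps)
    also have "\<dots> = 0" using 2 by simp
    finally have "z * (w * cnj w) - w * (z * cnj z) - z * z * cnj w = 0" .
    thus "poly ?p z = 0" unfolding 1 by (simp add: algebra_simps)
  qed
  show "finite {z. poly ?p z = 0}" using assms by (intro poly_roots_finite) auto
qed

text \<open>On a finite T the map would be onto and hence injective. A point other than c has
  several preimages, all in T, so T would be {c}; but 0 is a preimage of c and therefore also in
  T.\<close>

lemma backward_closed_infinite:
  fixes c :: "'a::{alg_closed_field, field_char_0}"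
  assumes alg: "\<And>x::'a. algebraic x" and d: "d \<ge> 2" and c: "c \<noteq> 0"
    and T: "\<And>x. x ^ d + c \<in> T \<Longrightarrow> x \<in> T" and "T \<noteq> {}"
  shows "infinite T"
proof
  assume fin: "finite T"
  let ?g = "\<lambda>x. x ^ d + c"
  have root: "\<exists>\<gamma>. \<gamma> ^ d = \<beta> - c" for \<beta> using nth_root_exists[of d "\<beta> - c"] d by auto
  have "T \<subseteq> ?g ` T"
  proof
    fix \<beta> assume "\<beta> \<in> T"
    obtain \<gamma> where "\<gamma> ^ d = \<beta> - c" using root by blast
    hence "\<beta> = ?g \<gamma>" by simp
    thus "\<beta> \<in> ?g ` T" using T[of \<gamma>] \<open>\<beta> \<in> T\<close> by blast
  qed
  hence inj: "inj_on ?g T" by (rule finite_surj_inj[OF fin])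
  have "d > 0" using d by simp
  obtain \<xi> :: 'a where \<xi>: "\<xi> ^ d = 1" "\<And>j. \<xi> ^ j = 1 \<Longrightarrow> d dvd j"
    by (rule primitive_root_of_unity[OF alg \<open>d > 0\<close>]) blast
  have "\<xi> \<noteq> 1" using \<xi>(2)[of 1] d by auto
  have Tc: "\<beta> = c" if "\<beta> \<in> T" for \<beta>
  proof (rule ccontr)
    assume "\<beta> \<noteq> c"
    obtain \<gamma> where \<gamma>: "\<gamma> ^ d = \<beta> - c" using root by blast
    have "\<gamma> \<noteq> 0" using \<gamma> \<open>\<beta> \<noteq> c\<close> d by (auto simp: power_0_left)
    have "\<gamma> \<in> T" "\<xi> * \<gamma> \<in> T" using T[of \<gamma>] T[of "\<xi> * \<gamma>"] \<gamma> \<xi>(1) \<open>\<beta> \<in> T\<close> by (simp_all add: power_mult_distrib)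
    hence "\<gamma> = \<xi> * \<gamma>" using \<xi>(1) by - (rule inj_onD[OF inj], simp_all add: power_mult_distrib)
    thus False using \<open>\<gamma> \<noteq> 0\<close> \<open>\<xi> \<noteq> 1\<close> by simp
  qed
  hence "c \<in> T" using \<open>T \<noteq> {}\<close> by blast
  hence "0 \<in> T" using T[of 0] d by (simp add: power_0_left)
  thus False using Tc[of 0] c by simp
qed

theorem periodic_unicritical_not_commuting:
  fixes A :: "'a::{alg_closed_field, field_char_0} set"
  assumes alg: "\<And>x::'a. algebraic x" and A: "finite A" and d: "d \<ge> 2" and c: "c \<noteq> 0"
    and per: "n \<ge> 1" "((\<lambda>x. x ^ d + c) ^^ n) 0 = 0"
    and T: "\<And>x. x ^ d + c \<in> T \<Longrightarrow> x \<in> T" "T \<noteq> {}"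
    and comm: "\<And>x \<sigma> \<tau>. x \<in> T \<Longrightarrow> \<sigma> \<in> field_auts A \<Longrightarrow> \<tau> \<in> field_auts A \<Longrightarrow> \<sigma> (\<tau> x) = \<tau> (\<sigma> x)"
  shows False
proof -
  \<comment> \<open>The roots produced by periodicity are products of tree points, so commutation is
    needed on a multiplicatively closed set containing the tree.\<close>
  define M where "M = {x. \<forall>\<sigma>\<in>field_auts A. \<forall>\<tau>\<in>field_auts A. \<sigma> (\<tau> x) = \<tau> (\<sigma> x)}"
  have hm: "\<sigma> (x * y) = \<sigma> x * \<sigma> y" and hp: "\<sigma> (x ^ k) = \<sigma> x ^ k" and h1: "\<sigma> 1 = 1"
    if "\<sigma> \<in> field_auts A" for \<sigma> x y k
    using field_auts_hom[OF that] by (simp_all add: field_hom_mult field_hom_power field_hom_1)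
  have M: "T \<subseteq> M" "1 \<in> M" "\<And>x y. x \<in> M \<Longrightarrow> y \<in> M \<Longrightarrow> x * y \<in> M" "\<And>x k. x \<in> M \<Longrightarrow> x ^ k \<in> M"
    using comm by (auto simp: M_def hm hp h1)
  obtain p where p: "normalization_semidom_class.prime p" "p dvd d"
    using prime_factor_nat[of d] d by auto
  then obtain e where e: "d = p * e" by blast
  obtain m where m: "n = Suc m" using per(1) by (cases n) auto
  have rou: "root_of_unity \<beta>" if \<beta>: "\<beta> \<in> T" "\<beta> \<noteq> 0" for \<beta>
  proof -
    \<comment> \<open>Adjoining \<beta> to the base shrinks the set of automorphisms, so commutation
      is inherited.\<close>
    have sub: "field_auts (insert \<beta> A) \<subseteq> field_auts A" by (intro field_auts_mono) blast
    have "root_of_unity (\<beta> ^ 2)"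
    proof (rule commuting_divisible_root_of_unity[OF alg _ p(1)])
      show "finite (insert \<beta> A)" using A by simp
      show "\<beta> ^ 2 \<in> fixed_field (insert \<beta> A)"
        by (intro fixed_field_power) (simp add: fixed_field_def field_auts_fixes)
      show "\<beta> ^ 2 \<noteq> 0" using \<beta>(2) by simp
      show "\<exists>y. y ^ p ^ k = \<beta> ^ 2 \<and> (\<forall>\<sigma>\<in>field_auts (insert \<beta> A). \<forall>\<tau>\<in>field_auts (insert \<beta> A).
          \<sigma> (\<tau> y) = \<tau> (\<sigma> y))" for k
      proof -
        obtain w where w: "w \<in> M" "\<beta> ^ 2 = w ^ (2 * d ^ k)"
          using periodic_tree_divisible[of d m c T M \<beta> k, OF _ _ T(1) M(1-3) \<beta>(1)] d per(2) m by auto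
        \<comment> \<open>From d = p e, the exponent 2 d^k is regrouped as (2 e^k) p^k.\<close>
        have "(w ^ (2 * e ^ k)) ^ (p ^ k) = \<beta> ^ 2"
          unfolding w(2) e by (simp add: power_mult_distrib mult_ac flip: power_mult)
        moreover have "w ^ (2 * e ^ k) \<in> M" by (rule M(4)[OF w(1)])
        ultimately show ?thesis using sub unfolding M_def by blast
      qed
    qed
    thus ?thesis by (rule root_of_unity_powerD) simp
  qed
  obtain \<iota> :: "'a \<Rightarrow> complex" where \<iota>: "field_hom \<iota>" using exists_complex_embedding[OF alg] by blast
  have norm: "cmod (\<iota> x) = 1" if x: "root_of_unity x" for x
  proof -
    obtain k where k: "k \<ge> 1" "x ^ k = 1" using x by (auto simp: root_of_unity_def)
    have "\<iota> x ^ k = 1" by (simp flip: field_hom_power[OF \<iota>] add: k(2) field_hom_1[OF \<iota>])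
    thus ?thesis using k(1) power_eq_1_iff[of _ k] by auto
  qed
  have "\<iota> c \<noteq> 0" using c by (simp add: field_hom_eq_0_iff[OF \<iota>])
  let ?S = "{z. cmod z = 1 \<and> cmod (z - \<iota> c) = 1}"
  \<comment> \<open>A point \<gamma> and the difference \<gamma> - c have modulus 1 as soon as they
    are nonzero, hence the two exceptions. Injectivity of \<iota> brings finiteness back from the
    complex plane.\<close>
  have "T \<subseteq> {0, c} \<union> \<iota> -` ?S"
  proof
    fix \<gamma> assume \<gamma>: "\<gamma> \<in> T"
    show "\<gamma> \<in> {0, c} \<union> \<iota> -` ?S"
    proof (cases "\<gamma> = 0 \<or> \<gamma> = c")
      case False
      obtain \<delta> where \<delta>: "\<delta> ^ d = \<gamma> - c" using nth_root_exists[of d "\<gamma> - c"] d by auto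
      have "\<delta> \<in> T" using T(1)[of \<delta>] \<gamma> \<delta> by simp
      moreover have "\<delta> \<noteq> 0" using \<delta> False d by (auto simp: power_0_left)
      ultimately have "cmod (\<iota> \<delta>) = 1" using rou norm by blast
      hence "cmod (\<iota> (\<gamma> - c)) = 1"
        by (simp flip: \<delta> add: field_hom_power[OF \<iota>] norm_power)
      moreover have "cmod (\<iota> \<gamma>) = 1" using rou norm \<gamma> False by blast
      ultimately show ?thesis by (simp add: field_hom_diff[OF \<iota>])
    qed auto
  qed
  moreover have "finite ({0, c} \<union> \<iota> -` ?S)"
    using finite_unit_circle_Int_translate[OF \<open>\<iota> c \<noteq> 0\<close>] field_hom_inj[OF \<iota>]
    by (simp add: finite_vimageI del: vimage_Collect_eq)
  ultimately have "finite T" by (rule finite_subset)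
  thus False using backward_closed_infinite[OF alg d c T] by blast
qed

section \<open>Galois groups inside the ambient field\<close>


lemma ambient_simps [simp]:
  "carrier ambient = UNIV" "x \<otimes>\<^bsub>ambient\<^esub> y = x * y" "\<one>\<^bsub>ambient\<^esub> = 1"
  "x \<oplus>\<^bsub>ambient\<^esub> y = x + y" "\<zero>\<^bsub>ambient\<^esub> = 0"
  by (simp_all add: ring_of_type_algebra_def)

lemma ambient_field: "field (ambient :: 'a::field ring)"
  by (rule field_from_type_algebra)

lemma ambient_a_inv [simp]: "\<ominus>\<^bsub>ambient\<^esub> x = - (x :: 'a::field)"
proof -
  interpret field "ambient :: 'a ring" by (rule ambient_field)
  show ?thesis by (rule minus_equality) simp_all
qed

lemma ambient_m_inv [simp]: "x \<noteq> 0 \<Longrightarrow> inv\<^bsub>ambient\<^esub> x = inverse (x :: 'a::field)"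
proof -
  interpret field "ambient :: 'a ring" by (rule ambient_field)
  show "x \<noteq> 0 \<Longrightarrow> inv\<^bsub>ambient\<^esub> x = inverse x" by (rule comm_inv_char) simp_all
qed

lemma ambient_pow [simp]: "x [^]\<^bsub>ambient\<^esub> (n::nat) = (x :: 'a::field) ^ n"
proof -
  interpret field "ambient :: 'a ring" by (rule ambient_field)
  show ?thesis by (induction n) simp_all
qed

lemma subfield_ambientD:
  fixes K :: "'a::field set"
  assumes K: "subfield K ambient"
  shows "1 \<in> K" "x \<in> K \<Longrightarrow> y \<in> K \<Longrightarrow> x + y \<in> K" "x \<in> K \<Longrightarrow> y \<in> K \<Longrightarrow> x * y \<in> K"
    "x \<in> K \<Longrightarrow> - x \<in> K" "x \<in> K \<Longrightarrow> inverse x \<in> K" "0 \<in> K"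
proof -
  interpret field "ambient :: 'a ring" by (rule ambient_field)
  note r = subringE[OF subfieldE(1)[OF K]]
  show "1 \<in> K" "0 \<in> K" using r(2,3) by simp_all
  show "x \<in> K \<Longrightarrow> y \<in> K \<Longrightarrow> x + y \<in> K" "x \<in> K \<Longrightarrow> y \<in> K \<Longrightarrow> x * y \<in> K" "x \<in> K \<Longrightarrow> - x \<in> K"
    using r(5)[of x] r(6)[of x y] r(7)[of x y] by simp_all
  show "inverse x \<in> K" if "x \<in> K"
    using subfield_m_inv(1)[OF K, of x] that \<open>0 \<in> K\<close> by (cases "x = 0") auto
qed

lemma subfield_ambientI:
  fixes K :: "'a::field set"
  assumes "1 \<in> K" "\<And>x y. x \<in> K \<Longrightarrow> y \<in> K \<Longrightarrow> x + y \<in> K" "\<And>x y. x \<in> K \<Longrightarrow> y \<in> K \<Longrightarrow> x * y \<in> K"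
    "\<And>x. x \<in> K \<Longrightarrow> - x \<in> K" "\<And>x. x \<in> K \<Longrightarrow> inverse x \<in> K"
  shows "subfield K ambient"
proof -
  interpret field "ambient :: 'a ring" by (rule ambient_field)
  show ?thesis using assms by (intro subfieldI' subringI) auto
qed

lemma partial_hom_subfield: "subfield K ambient \<Longrightarrow> partial_hom (Id_on K)"
  by (intro partial_hom_Id_onI) (auto dest: subfield_ambientD)

text \<open>The list polynomials start with the leading coefficient, whereas \<open>Poly\<close>
  starts with the constant term; hence the reversal.\<close>

lemma ambient_eval: "ring.eval (ambient :: 'a::field ring) p x = poly (Poly (rev p)) x"
proof -
  interpret field "ambient :: 'a ring" by (rule ambient_field)
  show ?thesis by (induction p) (simp_all add: Poly_snoc poly_monom)
qed

lemma ambient_algebraicD: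
  fixes x :: "'a::field"
  assumes K: "subfield K ambient" and x: "(ring.algebraic ambient over K) x"
  shows "\<exists>p. p \<noteq> 0 \<and> (\<forall>i. coeff p i \<in> K) \<and> poly p x = 0"
proof -
  interpret field "ambient :: 'a ring" by (rule ambient_field)
  obtain p where p: "p \<in> carrier (K [X]\<^bsub>ambient\<^esub>)" "p \<noteq> []" "eval p x = \<zero>\<^bsub>ambient\<^esub>"
    using algebraicE[OF subfieldE(1)[OF K] _ x] by auto
  hence set: "set p \<subseteq> K" "hd p \<noteq> 0" by (auto simp: univ_poly_def polynomial_def)
  have "Polynomial.coeff (Poly (rev p)) (length p - 1) = hd p"
    using p(2) by (simp add: nth_default_def rev_nth hd_conv_nth)
  hence "Poly (rev p) \<noteq> 0" using set(2) by (metis coeff_0)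
  moreover have "Polynomial.coeff (Poly (rev p)) i \<in> K" for i
    using set(1) subfield_ambientD(6)[OF K] nth_mem[of i "rev p"] by (auto simp: nth_default_def)
  moreover have "poly (Poly (rev p)) x = 0" using p(3) by (simp add: ambient_eval)
  ultimately show ?thesis by (intro exI[of _ "Poly (rev p)"]) blast
qed

lemma subfield_Rats: "subfield (\<rat> :: 'a::field_char_0 set) ambient"
  by (intro subfield_ambientI) auto

text \<open>Finite dimension is transitive along the tower from the rationals over K to K(x);
  clearing denominators in the resulting equation gives the integer coefficients that
  \<open>algebraic\<close> asks for.\<close>

lemma number_field_closure_algebraic:
  fixes K :: "'a::field_char_0 set"
  assumes K: "number_field K" and cl: "algebraic_closure (ambient :: 'a ring) K"
  shows "algebraic (x :: 'a)"
proof -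
  interpret field "ambient :: 'a ring" by (rule ambient_field)
  have sub: "subfield K ambient" and fin: "finite_dimension \<rat> K"
    using K by (auto simp: number_field_def)
  have "(ring.algebraic ambient over K) x"
    using algebraic_closure.algebraic_extension[OF cl] by simp
  hence "finite_dimension K (simple_extension K x)"
    using finite_dimension_simple_extension[OF sub] by simp
  hence "finite_dimension \<rat> (simple_extension K x)"
    by (rule telescopic_base_dim(1)[OF subfield_Rats sub fin])
  moreover have "subring (simple_extension K x) ambient"
    by (rule simple_extension_is_subring[OF subfieldE(1)[OF sub]]) simp
  moreover have "x \<in> simple_extension K x"
    by (rule simple_extension_mem[OF subfieldE(1)[OF sub]]) simp
  ultimately have "(ring.algebraic ambient over \<rat>) x"
    by (intro finite_dimension_imp_algebraic[OF subfield_Rats])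
  then obtain p where p: "p \<noteq> 0" "\<forall>i. Polynomial.coeff p i \<in> \<rat>" "poly p x = 0"
    using ambient_algebraicD[OF subfield_Rats] by blast
  obtain m q where mq: "m > 0" "smult (of_int m) p = map_poly of_int q"
    using common_denominator[OF p(2)] by blast
  show ?thesis
  proof (rule Polynomial.algebraicI)
    show "smult (of_int m) p \<noteq> 0" using p(1) mq(1) by simp
    show "Polynomial.coeff (smult (of_int m) p) i \<in> \<int>" for i by (simp add: mq(2) coeff_map_poly)
    show "poly (smult (of_int m) p) x = 0" using p(3) by simp
  qed
qed

text \<open>A basis of K over the rationals serves as \<open>A\<close>, since an automorphism fixing
  the basis fixes all rational combinations. This makes the results about finite sets available over
  K.\<close>

lemma number_field_finitely_generated:
  fixes K :: "'a::field_char_0 set"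
  assumes K: "number_field K"
  obtains A where "finite A" "field_auts A \<subseteq> field_auts K"
proof -
  interpret field "ambient :: 'a ring" by (rule ambient_field)
  obtain n where "dimension n \<rat> K" using K by (auto simp: number_field_def)
  then obtain Us where Us: "Span \<rat> Us = K" using exists_base[OF subfield_Rats] by blast
  have "\<sigma> x = x" if "\<sigma> \<in> field_auts (set Us)" "x \<in> Span \<rat> Us" for \<sigma> x
    using that
  proof (induction Us arbitrary: x)
    case Nil
    thus ?case using field_hom_0[OF field_auts_hom] by auto
  next
    case (Cons u Us)
    have h: "field_hom \<sigma>" using Cons.prems(1) by (rule field_auts_hom)
    obtain q v where "q \<in> \<rat>" "v \<in> Span \<rat> Us" "x = q * u + v"
      using Cons.prems(2) by (auto simp: line_extension_mem_iff)
    moreover have "\<sigma> \<in> field_auts (set Us)" "\<sigma> u = u" using Cons.prems(1) by (auto simp: field_auts_def)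
    ultimately show ?case
      using Cons.IH by (simp add: field_hom_add[OF h] field_hom_mult[OF h] field_hom_Rats[OF h])
  qed
  from this[unfolded Us] have "field_auts (set Us) \<subseteq> field_auts K"
    by (auto simp: field_auts_def)
  thus thesis using that by blast
qed

lemma subfield_generate_field: "subfield (generate_field ambient H) (ambient :: 'a::field ring)"
proof -
  interpret field "ambient :: 'a ring" by (rule ambient_field)
  show ?thesis by (rule generate_field_is_subfield) simp
qed

section \<open>Galois groups, and commutation tested at elements\<close>

lemma Gal_mult:
  "\<sigma> \<in> carrier (Gal L K) \<Longrightarrow> \<tau> \<in> carrier (Gal L K) \<Longrightarrow> \<sigma> \<otimes>\<^bsub>Gal L K\<^esub> \<tau> = compose L \<sigma> \<tau>"
  by (simp add: Gal_def BijGroup_def)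

lemma Gal_carrier_iff:
  assumes L: "subfield L ambient"
  shows "\<sigma> \<in> carrier (Gal L K) \<longleftrightarrow> \<sigma> \<in> extensional L \<and> bij_betw \<sigma> L L \<and> \<sigma> 1 = 1 \<and>
    (\<forall>x\<in>L. \<forall>y\<in>L. \<sigma> (x + y) = \<sigma> x + \<sigma> y \<and> \<sigma> (x * y) = \<sigma> x * \<sigma> y) \<and> (\<forall>x\<in>K. \<sigma> x = x)"
  using bij_betwE[of \<sigma> L L] by (auto simp: Gal_def Bij_def ring_hom_def)

lemma Gal_group:
  fixes L K :: "'a::field set"
  assumes L: "subfield L ambient" and KL: "K \<subseteq> L"
  shows "group (Gal L K)"
proof -
  have "subgroup (carrier (Gal L K)) (BijGroup L)"
  proof (rule group.subgroupI[OF group_BijGroup])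
    show "carrier (Gal L K) \<subseteq> carrier (BijGroup L)" by (auto simp: Gal_def BijGroup_def)
    have "restrict id L \<in> carrier (Gal L K)"
      using KL subfield_ambientD[OF L] by (auto simp: Gal_carrier_iff[OF L] bij_betw_def inj_on_def)
    thus "carrier (Gal L K) \<noteq> {}" by blast
  next
    fix \<sigma> assume s: "\<sigma> \<in> carrier (Gal L K)"
    have bij: "bij_betw \<sigma> L L" and fixK: "\<forall>x\<in>K. \<sigma> x = x" and "\<sigma> 1 = 1"
      and hom: "\<And>x y. x \<in> L \<Longrightarrow> y \<in> L \<Longrightarrow> \<sigma> (x + y) = \<sigma> x + \<sigma> y \<and> \<sigma> (x * y) = \<sigma> x * \<sigma> y"
      using s by (auto simp: Gal_carrier_iff[OF L])
    have B: "\<sigma> \<in> Bij L" using s by (auto simp: Gal_def)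
    let ?i = "inv_into L \<sigma>"
    have i: "?i y \<in> L" "\<sigma> (?i y) = y" if "y \<in> L" for y
      using bij that by (auto simp: bij_betw_def intro: inv_into_into f_inv_into_f)
    have i2: "?i (\<sigma> x) = x" if "x \<in> L" for x
      using bij that by (auto simp: bij_betw_def inv_into_f_f)
    have "restrict ?i L \<in> carrier (Gal L K)"
      unfolding Gal_carrier_iff[OF L]
    proof (intro conjI ballI)
      show "bij_betw (restrict ?i L) L L"
        using bij_betw_inv_into[OF bij] by (simp cong: bij_betw_cong)
      show "restrict ?i L 1 = 1"
        using i2[of 1] \<open>\<sigma> 1 = 1\<close> subfield_ambientD(1)[OF L] by simp
      show "restrict ?i L x = x" if "x \<in> K" for x
        using i2[of x] fixK KL that by (auto simp: restrict_def)
      fix x y assume xy: "x \<in> L" "y \<in> L"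
      show "restrict ?i L (x + y) = restrict ?i L x + restrict ?i L y"
        using i2[of "?i x + ?i y"] hom[of "?i x" "?i y"] i xy subfield_ambientD(2)[OF L] by simp
      show "restrict ?i L (x * y) = restrict ?i L x * restrict ?i L y"
        using i2[of "?i x * ?i y"] hom[of "?i x" "?i y"] i xy subfield_ambientD(3)[OF L] by simp
    qed simp
    thus "inv\<^bsub>BijGroup L\<^esub> \<sigma> \<in> carrier (Gal L K)" by (simp add: inv_BijGroup[OF B])
    fix \<tau> assume t: "\<tau> \<in> carrier (Gal L K)"
    have B': "\<tau> \<in> Bij L" using t by (auto simp: Gal_def)
    have "compose L \<sigma> \<tau> \<in> carrier (Gal L K)"
      unfolding Gal_carrier_iff[OF L]
    proof (intro conjI)
      show "bij_betw (compose L \<sigma> \<tau>) L L" using compose_Bij[OF B B'] by (simp add: Bij_def)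
      have "\<And>x. x \<in> L \<Longrightarrow> \<tau> x \<in> L" using Bij_imp_funcset[OF B'] by auto
      thus "\<forall>x\<in>L. \<forall>y\<in>L. compose L \<sigma> \<tau> (x + y) = compose L \<sigma> \<tau> x + compose L \<sigma> \<tau> y \<and>
          compose L \<sigma> \<tau> (x * y) = compose L \<sigma> \<tau> x * compose L \<sigma> \<tau> y"
        using t hom subfield_ambientD(2,3)[OF L] by (simp add: compose_def Gal_carrier_iff[OF L])
    qed (use s t KL subfield_ambientD(1)[OF L] in \<open>auto simp: compose_def Gal_carrier_iff[OF L]\<close>)
    thus "\<sigma> \<otimes>\<^bsub>BijGroup L\<^esub> \<tau> \<in> carrier (Gal L K)" using B B' by (simp add: BijGroup_def)
  qed
  from subgroup.subgroup_is_group[OF this group_BijGroup] show ?thesis by (simp add: Gal_def)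
qed

lemma Gal_comm_group_iff:
  fixes L K :: "'a::field set"
  assumes L: "subfield L ambient" and KL: "K \<subseteq> L"
  shows "comm_group (Gal L K) \<longleftrightarrow>
    (\<forall>\<sigma>\<in>carrier (Gal L K). \<forall>\<tau>\<in>carrier (Gal L K). \<forall>x\<in>L. \<sigma> (\<tau> x) = \<tau> (\<sigma> x))"
proof
  assume "comm_group (Gal L K)"
  then interpret comm_group "Gal L K" .
  show "\<forall>\<sigma>\<in>carrier (Gal L K). \<forall>\<tau>\<in>carrier (Gal L K). \<forall>x\<in>L. \<sigma> (\<tau> x) = \<tau> (\<sigma> x)"
  proof (intro ballI)
    fix \<sigma> \<tau> x assume st: "\<sigma> \<in> carrier (Gal L K)" "\<tau> \<in> carrier (Gal L K)" and x: "x \<in> L"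
    have "compose L \<sigma> \<tau> x = compose L \<tau> \<sigma> x" using m_comm[OF st] st by (simp add: Gal_mult)
    thus "\<sigma> (\<tau> x) = \<tau> (\<sigma> x)" using x by (simp add: compose_def)
  qed
next
  assume comm: "\<forall>\<sigma>\<in>carrier (Gal L K). \<forall>\<tau>\<in>carrier (Gal L K). \<forall>x\<in>L. \<sigma> (\<tau> x) = \<tau> (\<sigma> x)"
  show "comm_group (Gal L K)"
    by (rule group.group_comm_groupI[OF Gal_group[OF L KL]])
      (use comm in \<open>simp add: Gal_mult compose_def restrict_def fun_eq_iff\<close>)
qed

text \<open>Normality of \<open>K(S)\<close> enters as invariance of \<open>S\<close> under the automorphisms of the ambient field.\<close>

context
  fixes K S :: "'a::{alg_closed_field, field_char_0} set"
  assumes K: "subfield K ambient" and cl: "algebraic_closure (ambient :: 'a ring) K"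
    and S: "\<And>\<sigma> x. \<sigma> \<in> field_auts K \<Longrightarrow> x \<in> S \<Longrightarrow> \<sigma> x \<in> S"
begin

private abbreviation "L \<equiv> generate_field ambient (K \<union> S)"

lemma generate_field_auts_invariant:
  assumes "\<sigma> \<in> field_auts K" "x \<in> L"
  shows "\<sigma> x \<in> L"
  using assms(2)
proof induction
  case (incl h)
  thus ?case using S[OF assms(1)] field_auts_fixes[OF assms(1)]
    by (auto intro: generate_field.incl)
qed (use field_auts_hom[OF assms(1)] in \<open>auto simp: field_hom_1 field_hom_uminus field_hom_inverse
    field_hom_add field_hom_mult subfield_ambientD[OF subfield_generate_field]\<close>)

lemma restrict_in_Gal:
  assumes s: "\<sigma> \<in> field_auts K"
  shows "restrict \<sigma> L \<in> carrier (Gal L K)"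
proof -
  note sub = subfield_generate_field[of "K \<union> S"]
  have h: "field_hom \<sigma>" by (rule field_auts_hom[OF s])
  have "\<sigma> ` L = L"
  proof safe
    fix y assume y: "y \<in> L"
    show "\<sigma> y \<in> L" by (rule generate_field_auts_invariant[OF s y])
    have "inv_into UNIV \<sigma> y \<in> L" by (rule generate_field_auts_invariant[OF field_auts_inv[OF s] y])
    moreover have "y = \<sigma> (inv_into UNIV \<sigma> y)"
      using field_auts_bij[OF s] by (simp add: bij_is_surj surj_f_inv_f)
    ultimately show "y \<in> \<sigma> ` L" by blast
  qed
  hence "bij_betw (restrict \<sigma> L) L L"
    using field_hom_inj[OF h] by (auto simp: bij_betw_def inj_on_def inj_def)
  moreover have "K \<subseteq> L" by (auto intro: generate_field.incl)
  ultimately show ?thesis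
    using subfield_ambientD(1-3)[OF sub] field_auts_fixes[OF s]
    by (auto simp: Gal_carrier_iff[OF sub] field_hom_1[OF h] field_hom_add[OF h] field_hom_mult[OF h])
qed

text \<open>An element outside K is moved by an ambient automorphism, and by invariance of
  \<open>S\<close> that automorphism restricts to an element of the Galois group.\<close>

lemma galois_extension_generate_field: "galois_extension K L"
proof -
  have KL: "K \<subseteq> L" by (auto intro: generate_field.incl)
  have alg: "(ring.algebraic ambient over K) x" for x :: 'a
    using algebraic_closure.algebraic_extension[OF cl] by simp
  have "x \<in> K" if x: "x \<in> L" "\<forall>\<sigma>\<in>carrier (Gal L K). \<sigma> x = x" for x
  proof (rule ccontr)
    assume "x \<notin> K"
    then obtain \<sigma> where "\<sigma> \<in> field_auts K" "\<sigma> x \<noteq> x"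
      using field_auts_moves[OF partial_hom_subfield[OF K] ambient_algebraicD[OF K alg]] by blast
    thus False using x restrict_in_Gal by fastforce
  qed
  moreover have "\<sigma> x = x" if "\<sigma> \<in> carrier (Gal L K)" "x \<in> K" for \<sigma> x
    using that by (simp add: Gal_def)
  ultimately show ?thesis
    using K KL alg subfield_generate_field[of "K \<union> S"] unfolding galois_extension_def by blast
qed

lemma Gal_commD:
  assumes "comm_group (Gal L K)" "\<sigma> \<in> field_auts K" "\<tau> \<in> field_auts K" "x \<in> L"
  shows "\<sigma> (\<tau> x) = \<tau> (\<sigma> x)"
proof -
  have "K \<subseteq> L" by (auto intro: generate_field.incl)
  hence "restrict \<sigma> L (restrict \<tau> L x) = restrict \<tau> L (restrict \<sigma> L x)"
    using assms Gal_comm_group_iff[OF subfield_generate_field[of "K \<union> S"]] restrict_in_Gal by blast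
  thus ?thesis using assms generate_field_auts_invariant by simp
qed

end

text \<open>The points of L at which \<sigma> and \<tau> commute form a subfield containing K, so
  the generators in \<open>S\<close> decide. Elements of the group are maps controlled on L alone,
  so compatibility with negation and inversion is derived there.\<close>

lemma Gal_commI:
  fixes K S :: "'a::field set"
  defines "L \<equiv> generate_field ambient (K \<union> S)"
  assumes comm: "\<And>\<sigma> \<tau> x. \<sigma> \<in> carrier (Gal L K) \<Longrightarrow> \<tau> \<in> carrier (Gal L K) \<Longrightarrow> x \<in> S \<Longrightarrow> \<sigma> (\<tau> x) = \<tau> (\<sigma> x)"
  shows "comm_group (Gal L K)"
proof -
  have sub: "subfield L ambient" unfolding L_def by (rule subfield_generate_field)
  have KL: "K \<subseteq> L" unfolding L_def by (auto intro: generate_field.incl)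
  have "\<sigma> (\<tau> x) = \<tau> (\<sigma> x)" if st: "\<sigma> \<in> carrier (Gal L K)" "\<tau> \<in> carrier (Gal L K)" and x: "x \<in> L" for \<sigma> \<tau> x
  proof -
    define F where "F = {x \<in> L. \<sigma> (\<tau> x) = \<tau> (\<sigma> x)}"
    have cl: "\<rho> x \<in> L" "\<rho> 1 = 1" if "\<rho> \<in> carrier (Gal L K)" "x \<in> L" for \<rho> x
      using that bij_betwE[of \<rho> L L] by (auto simp: Gal_carrier_iff[OF sub])
    have hom: "\<rho> (x + y) = \<rho> x + \<rho> y" "\<rho> (x * y) = \<rho> x * \<rho> y"
      if "\<rho> \<in> carrier (Gal L K)" "x \<in> L" "y \<in> L" for \<rho> x y
      using that bij_betwE[of \<rho> L L] by (auto simp: Gal_carrier_iff[OF sub])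
    note hs = cl[OF st(1)] hom[OF st(1)] and ht = cl[OF st(2)] hom[OF st(2)]
    have uminus: "\<rho> (- x) = - \<rho> x" if r: "\<rho> \<in> carrier (Gal L K)" "x \<in> L" for \<rho> x
      using hom(1)[OF r subfield_ambientD(4)[OF sub r(2)]]
        hom(1)[OF r(1) subfield_ambientD(6)[OF sub] subfield_ambientD(6)[OF sub]]
      by (simp add: add_eq_0_iff)
    have inverse: "\<rho> (inverse x) = inverse (\<rho> x)" if r: "\<rho> \<in> carrier (Gal L K)" "x \<in> L" "x \<noteq> 0" for \<rho> x
      using hom(2)[OF r(1,2) subfield_ambientD(5)[OF sub r(2)]] cl(2)[OF r(1,2)] r(3)
      by (intro inverse_unique[symmetric]) simp
    have nz: "\<rho> x \<noteq> 0" if r: "\<rho> \<in> carrier (Gal L K)" "x \<in> L" "x \<noteq> 0" for \<rho> x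
      using hom(2)[OF r(1,2) subfield_ambientD(5)[OF sub r(2)]] cl(2)[OF r(1,2)] r(3) by auto
    have "x \<in> F" if "x \<in> L" for x
      using that unfolding L_def
    proof induction
      case one
      show ?case using hs(2) ht(2) subfield_ambientD(1)[OF sub] by (auto simp: F_def)
    next
      case (incl h)
      hence "h \<in> L" unfolding L_def by (auto intro: generate_field.incl)
      thus ?case using incl comm[OF st] st KL by (auto simp: F_def Gal_carrier_iff[OF sub])
    next
      case (a_inv h)
      thus ?case using subfield_ambientD(4)[OF sub] uminus[OF st(1)] uminus[OF st(2)] hs(1) ht(1) by (auto simp: F_def)
    next
      case (m_inv h)
      thus ?case using subfield_ambientD(5)[OF sub] inverse[OF st(1)] inverse[OF st(2)] hs(1) ht(1) nz[OF st(1)] nz[OF st(2)] by (auto simp: F_def)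
    next
      case (eng_add h1 h2)
      thus ?case using subfield_ambientD(2)[OF sub] hs(1,3) ht(1,3) by (auto simp: F_def)
    next
      case (eng_mult h1 h2)
      thus ?case using subfield_ambientD(3)[OF sub] hs(1,4) ht(1,4) by (auto simp: F_def)
    qed
    thus ?thesis using x by (simp add: F_def)
  qed
  thus ?thesis using Gal_comm_group_iff[OF sub KL] by blast
qed

section \<open>Roots of unity and abelian extensions\<close>

lemma root_of_unity_powers:
  assumes alg: "\<And>x::'a::{alg_closed_field, field_char_0}. algebraic x" and x: "root_of_unity (x :: 'a)"
  shows "\<exists>n\<ge>1. x ^ n = 1 \<and> (\<forall>y. y ^ n = 1 \<longrightarrow> (\<exists>i. y = x ^ i))"
proof -
  define n where "n = (LEAST n. n \<ge> 1 \<and> x ^ n = 1)"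
  have n: "n \<ge> 1" "x ^ n = 1" "\<And>m. m \<ge> 1 \<Longrightarrow> x ^ m = 1 \<Longrightarrow> n \<le> m"
    using x LeastI_ex[of "\<lambda>n. n \<ge> 1 \<and> x ^ n = 1"] Least_le[of "\<lambda>n. n \<ge> 1 \<and> x ^ n = 1"]
    unfolding root_of_unity_def n_def by blast+
  have "n > 0" using n(1) by simp
  obtain g :: 'a where g: "g ^ n = 1" "\<And>y. y ^ n = 1 \<Longrightarrow> \<exists>j. y = g ^ j"
    by (rule primitive_root_of_unity[OF alg \<open>n > 0\<close>]) blast
  obtain j where "x = g ^ j" using g(2) n(2) by blast
  \<comment> \<open>The shift by n leaves x unchanged and makes the exponent nonzero, as
    \<open>bezout_nat\<close> requires.\<close>
  have j: "x = g ^ (j + n)" using \<open>x = g ^ j\<close> g(1) by (simp add: power_add)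
  \<comment> \<open>A common factor k of the exponent and n gives x^(n/k) = 1, so minimality of n
    forces k = 1, and the Bezout relation writes the generator g as a power of x.\<close>
  define k where "k = gcd (j + n) n"
  have k: "k dvd j + n" "k dvd n" unfolding k_def by simp_all
  obtain q where q: "j + n = k * q" using k(1) by blast
  obtain r where r: "n = k * r" using k(2) by blast
  have "x ^ r = (g ^ n) ^ q" unfolding j q by (subst r) (simp add: mult_ac flip: power_mult)
  hence "x ^ r = 1" using g(1) by simp
  moreover have "r \<ge> 1" using r \<open>n > 0\<close> by (cases r) auto
  ultimately have "n \<le> r" using n(3) by blast
  hence "k = 1" using r \<open>n > 0\<close> by (cases k) auto
  have "j + n \<noteq> 0" using \<open>n > 0\<close> by simp
  then obtain i l where "(j + n) * i = n * l + gcd (j + n) n" using bezout_nat by blast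
  hence il: "(j + n) * i = n * l + 1" using \<open>k = 1\<close> by (simp add: k_def)
  have "x ^ i = g ^ ((j + n) * i)" by (simp only: j power_mult)
  also have "\<dots> = g" unfolding il using g(1) by (simp add: power_add power_mult)
  finally have "x ^ i = g" .
  thus ?thesis using n(1,2) g(2) by (metis power_mult)
qed

text \<open>Every group element sends x to a power of x, and raising to powers commutes.\<close>

lemma Gal_comm_root_of_unity:
  fixes L K :: "'a::{alg_closed_field, field_char_0} set"
  assumes alg: "\<And>x::'a. algebraic x" and L: "subfield L ambient"
    and st: "\<sigma> \<in> carrier (Gal L K)" "\<tau> \<in> carrier (Gal L K)" and x: "x \<in> L" "root_of_unity x"
  shows "\<sigma> (\<tau> x) = \<tau> (\<sigma> x)"
proof -
  have pow: "x ^ k \<in> L \<and> \<rho> (x ^ k) = \<rho> x ^ k" if "\<rho> \<in> carrier (Gal L K)" for \<rho> k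
    using that x(1) subfield_ambientD(1,3)[OF L] by (induction k) (simp_all add: Gal_carrier_iff[OF L])
  have one: "\<rho> 1 = 1" if "\<rho> \<in> carrier (Gal L K)" for \<rho>
    using that by (simp add: Gal_carrier_iff[OF L])
  obtain n where n: "n \<ge> 1" "x ^ n = 1" "\<And>y. y ^ n = 1 \<Longrightarrow> \<exists>i. y = x ^ i"
    using root_of_unity_powers[OF alg x(2)] by blast
  have "\<sigma> x ^ n = 1" "\<tau> x ^ n = 1"
    using pow[OF st(1), of n] pow[OF st(2), of n] one[OF st(1)] one[OF st(2)] n(2) by simp_all
  then obtain i j where ij: "\<sigma> x = x ^ i" "\<tau> x = x ^ j" using n(3) by meson
  show ?thesis
    using pow[OF st(1), of j] pow[OF st(2), of i] by (simp add: ij mult.commute flip: power_mult)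
qed

text \<open>Adjoining all n-th roots of unity to K gives an abelian extension that contains the
  quotient. For \<gamma> = u \<alpha> the quotient is 1/u, the scaling that normalises the leading
  coefficient.\<close>

lemma root_of_unity_quotient_in_max_abelian_extension:
  fixes K :: "'a::{alg_closed_field, field_char_0} set"
  assumes alg: "\<And>x::'a. algebraic x"
    and K: "subfield K ambient" and cl: "algebraic_closure (ambient :: 'a ring) K"
    and \<alpha>: "\<alpha> \<in> K" and \<gamma>: "root_of_unity \<gamma>"
  shows "\<alpha> / \<gamma> \<in> max_abelian_extension K"
proof -
  obtain n where n: "n \<ge> 1" "\<gamma> ^ n = 1" using \<gamma> by (auto simp: root_of_unity_def)
  define S where "S = {x :: 'a. x ^ n = 1}"
  define L where "L = generate_field ambient (K \<union> S)"
  have sub: "subfield L ambient" unfolding L_def by (rule subfield_generate_field)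
  have SL: "x \<in> L" if "x \<in> K \<union> S" for x using that unfolding L_def by (rule generate_field.incl)
  have "galois_extension K L"
    unfolding L_def
  proof (rule galois_extension_generate_field[OF K cl])
    show "\<sigma> x \<in> S" if "\<sigma> \<in> field_auts K" "x \<in> S" for \<sigma> x
      using that field_auts_hom[OF that(1)]
      by (simp add: S_def field_hom_1 flip: field_hom_power)
  qed
  moreover have "comm_group (Gal L K)"
    unfolding L_def
    by (rule Gal_commI, fold L_def, rule Gal_comm_root_of_unity[OF alg sub])
      (use n(1) SL in \<open>auto simp: S_def root_of_unity_def\<close>)
  ultimately have "L \<subseteq> \<Union> {L. abelian_extension K L}"
    by (auto simp: abelian_extension_def)
  moreover have "\<alpha> / \<gamma> \<in> L"
    unfolding divide_inverse using \<alpha> n(2)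
    by (intro subfield_ambientD[OF sub] SL) (auto simp: S_def)
  ultimately show ?thesis
    unfolding max_abelian_extension_def by (blast intro: generate_field.incl)
qed

section \<open>The abelian criterion for \<open>f = a x^d + c\<close>\<close>

theorem theorem1p2:
  fixes K :: "'a::{alg_closed_field, field_char_0} set"
    and d :: nat and a c \<alpha> :: 'a and f :: "'a poly"
  assumes "number_field K"
    and "algebraic_closure (ambient :: 'a ring) K"
    and "d \<ge> 2"
    and "a \<in> K" and "c \<in> K" and "\<alpha> \<in> K" and "a \<noteq> 0"
    and "f = monom a d + [:c:]"
    and "periodic_point f 0"
  shows "(comm_group (G_infty K f \<alpha>) \<longleftrightarrow>
            c = 0 \<and>
            (\<alpha> = 0 \<or>
             (\<exists>\<gamma>. (\<gamma> = 0 \<or> root_of_unity \<gamma>) \<and>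
                  conjugate_over (max_abelian_extension K) (f, \<alpha>) (monom 1 d, \<gamma>)))) \<and>
         (a = 1 \<and> comm_group (G_infty K f \<alpha>) \<longrightarrow>
            c = 0 \<and> (\<alpha> = 0 \<or> root_of_unity \<alpha>))"
proof -
  note nf = assms(1) and cl = assms(2) and d = assms(3)
  have K: "subfield K ambient" using nf by (simp add: number_field_def)
  have alg: "algebraic x" for x :: 'a by (rule number_field_closure_algebraic[OF nf cl])
  have f: "poly f x = a * x ^ d + c" for x by (simp add: assms(8) poly_monom)
  define S where "S = preimage_tree f \<alpha>"
  have S_iff: "x \<in> S \<longleftrightarrow> (\<exists>n. (poly f ^^ n) x = \<alpha>)" for x by (auto simp: S_def preimage_tree_def)
  define L where "L = generate_field ambient (K \<union> S)"
  have G: "G_infty K f \<alpha> = Gal L K" by (simp add: G_infty_def K_infty_def L_def S_def)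
  have sub: "subfield L ambient" unfolding L_def by (rule subfield_generate_field)
  have inL: "x \<in> L" if "x \<in> K \<union> S" for x using that unfolding L_def by (rule generate_field.incl)
  have S_inv: "\<sigma> x \<in> S" if s: "\<sigma> \<in> field_auts K" and x: "x \<in> S" for \<sigma> x
  proof -
    have h: "field_hom \<sigma>" by (rule field_auts_hom[OF s])
    have step: "\<sigma> (poly f y) = poly f (\<sigma> y)" for y
      using field_auts_fixes[OF s] assms(4,5)
      by (simp add: f field_hom_add[OF h] field_hom_mult[OF h] field_hom_power[OF h])
    have "\<sigma> ((poly f ^^ n) x) = (poly f ^^ n) (\<sigma> x)" for n by (induction n) (simp_all add: step)
    thus ?thesis using x field_auts_fixes[OF s assms(6)] unfolding S_iff by metis
  qed
  obtain u where u: "u ^ (d - 1) = a" using nth_root_exists[of "d - 1" a] d by auto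
  have "u \<noteq> 0" using u assms(7) d by (auto simp: power_0_left)
  have ud: "u ^ d = u * a" using d by (simp flip: u add: power_eq_if)
  obtain A0 where A0: "finite A0" "field_auts A0 \<subseteq> field_auts K"
    by (rule number_field_finitely_generated[OF nf])
  \<comment> \<open>With u among the generators, every automorphism in \<open>field_auts A\<close>
    commutes with the scaling by u, so commutation passes from the tree \<open>S\<close> of f to its
    scaled copy \<open>T\<close>.\<close>
  define A where "A = insert u A0"
  have A: "finite A" "field_auts A \<subseteq> field_auts K"
    using A0 field_auts_mono[of A0 A] by (auto simp: A_def)
  let ?g = "\<lambda>x. x ^ d + u * c"
  define T where "T = (\<lambda>x. u * x) ` S"
  have gu: "?g (u * x) = u * poly f x" for x by (simp add: power_mult_distrib ud f algebra_simps)
  have "\<alpha> \<in> S" unfolding S_iff by (intro exI[of _ 0]) simp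
  hence T\<alpha>: "u * \<alpha> \<in> T" unfolding T_def by (rule imageI)
  have T_back: "x \<in> T" if gx: "?g x \<in> T" for x
  proof -
    obtain y where y: "y \<in> S" "?g x = u * y" using gx by (auto simp: T_def)
    have "x = u * (x / u)" using \<open>u \<noteq> 0\<close> by simp
    hence "poly f (x / u) = y" using gu[of "x / u"] y(2) \<open>u \<noteq> 0\<close> by simp
    moreover obtain n where "(poly f ^^ n) y = \<alpha>" using y(1) S_iff by blast
    ultimately have "(poly f ^^ Suc n) (x / u) = \<alpha>" by (simp add: funpow_swap1)
    hence "x / u \<in> S" unfolding S_iff by blast
    thus ?thesis using \<open>x = u * (x / u)\<close> unfolding T_def by blast
  qed
  have commT: "\<sigma> (\<tau> x) = \<tau> (\<sigma> x)"
    if comm: "comm_group (G_infty K f \<alpha>)" and x: "x \<in> T" and st: "\<sigma> \<in> field_auts A" "\<tau> \<in> field_auts A" for \<sigma> \<tau> x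
  proof -
    obtain y where y: "y \<in> S" "x = u * y" using x by (auto simp: T_def)
    have "\<sigma> (\<tau> y) = \<tau> (\<sigma> y)"
    proof (rule Gal_commD[OF K cl, of S])
      show "\<sigma> x \<in> S" if "\<sigma> \<in> field_auts K" "x \<in> S" for \<sigma> x by (rule S_inv[OF that])
      show "comm_group (Gal (generate_field ambient (K \<union> S)) K)" using comm unfolding G L_def .
      show "y \<in> generate_field ambient (K \<union> S)" using inL y(1) unfolding L_def by blast
    qed (use st A(2) in blast)+
    thus ?thesis
      using field_auts_fixes[OF st(1), of u] field_auts_fixes[OF st(2), of u]
      by (simp add: y(2) A_def field_hom_mult[OF field_auts_hom[OF st(1)]] field_hom_mult[OF field_auts_hom[OF st(2)]])
  qed
  have c0: "c = 0" if comm: "comm_group (G_infty K f \<alpha>)"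
  proof (rule ccontr)
    assume "c \<noteq> 0"
    obtain n where n: "n \<ge> 1" "(poly f ^^ n) 0 = 0" using assms(9) by (auto simp: periodic_point_def)
    have "(?g ^^ k) (u * x) = u * (poly f ^^ k) x" for k x by (induction k) (simp_all only: funpow.simps id_apply o_apply gu)
    from this[of n 0] have "(?g ^^ n) 0 = 0" using n(2) by simp
    show False
    proof (rule periodic_unicritical_not_commuting[OF alg A(1) d _ n(1) \<open>(?g ^^ n) 0 = 0\<close>])
      show "u * c \<noteq> 0" using \<open>c \<noteq> 0\<close> \<open>u \<noteq> 0\<close> by simp
      show "x \<in> T" if "?g x \<in> T" for x by (rule T_back[OF that])
      show "T \<noteq> {}" using T\<alpha> by blast
      show "\<sigma> (\<tau> x) = \<tau> (\<sigma> x)" if "x \<in> T" "\<sigma> \<in> field_auts A" "\<tau> \<in> field_auts A" for x \<sigma> \<tau>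
        by (rule commT[OF comm that])
    qed
  qed
  have rou: "root_of_unity (u * \<alpha>)" if comm: "comm_group (G_infty K f \<alpha>)" and "\<alpha> \<noteq> 0"
  proof -
    have c: "c = 0" by (rule c0[OF comm])
    obtain p where p: "normalization_semidom_class.prime p" "p dvd d"
      using prime_factor_nat[of d] d by auto
    then obtain e where e: "d = p * e" by blast
    have hp: "\<sigma> (x ^ k) = \<sigma> x ^ k" if "\<sigma> \<in> field_auts A" for \<sigma> x k
      by (rule field_hom_power[OF field_auts_hom[OF that]])
    \<comment> \<open>For c = 0 the tree contains all d^k-th roots of u \<alpha>, so divisibility is
      immediate and involves no sign.\<close>
    have Tk: "x \<in> T" if "x ^ (d ^ k) \<in> T" for x k
      using that
    proof (induction k arbitrary: x)
      case (Suc k)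
      have "(x ^ d) ^ (d ^ k) \<in> T" using Suc.prems by (simp add: power_mult)
      hence "?g x \<in> T" using Suc.IH c by simp
      thus ?case by (rule T_back)
    qed simp
    show ?thesis
    proof (rule commuting_divisible_root_of_unity[OF alg A(1) p(1)])
      show "u * \<alpha> \<in> fixed_field A"
        using A(2) assms(6) by (intro fixed_field_mult) (auto simp: fixed_field_def A_def field_auts_fixes)
      show "u * \<alpha> \<noteq> 0" using \<open>u \<noteq> 0\<close> \<open>\<alpha> \<noteq> 0\<close> by simp
      show "\<exists>y. y ^ p ^ k = u * \<alpha> \<and> (\<forall>\<sigma>\<in>field_auts A. \<forall>\<tau>\<in>field_auts A. \<sigma> (\<tau> y) = \<tau> (\<sigma> y))" for k
      proof -
        obtain x where x: "x ^ (d ^ k) = u * \<alpha>" using nth_root_exists[of "d ^ k" "u * \<alpha>"] d by auto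
        hence "x \<in> T" using Tk T\<alpha> by metis
        have "(x ^ (e ^ k)) ^ p ^ k = u * \<alpha>"
          unfolding x[symmetric] e by (simp add: power_mult_distrib mult_ac flip: power_mult)
        thus ?thesis using commT[OF comm \<open>x \<in> T\<close>] by (intro exI[of _ "x ^ (e ^ k)"]) (simp add: hp)
      qed
    qed
  qed
  have fwd: "c = 0 \<and> (\<alpha> = 0 \<or> (\<exists>\<gamma>. (\<gamma> = 0 \<or> root_of_unity \<gamma>) \<and>
      conjugate_over (max_abelian_extension K) (f, \<alpha>) (monom 1 d, \<gamma>)))"
    if comm: "comm_group (G_infty K f \<alpha>)"
  proof (cases "\<alpha> = 0")
    case False
    have c: "c = 0" by (rule c0[OF comm])
    have \<gamma>: "root_of_unity (u * \<alpha>)" by (rule rou[OF comm False])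
    have "\<alpha> / (u * \<alpha>) \<in> max_abelian_extension K"
      by (rule root_of_unity_quotient_in_max_abelian_extension[OF alg K cl assms(6) \<gamma>])
    hence uE: "1 / u \<in> max_abelian_extension K" using False by simp
    have zE: "0 \<in> max_abelian_extension K"
      unfolding max_abelian_extension_def by (rule subfield_ambientD(6)[OF subfield_generate_field])
    have "pcompose [:- 0 / (1 / u), 1 / (1 / u):] (pcompose f [:0, 1 / u:]) = monom 1 d"
    proof (subst poly_eq_poly_eq_iff[symmetric], rule ext)
      fix x
      have "u * a / u ^ d = 1" using ud \<open>u \<noteq> 0\<close> assms(7) by simp
      thus "poly (pcompose [:- 0 / (1 / u), 1 / (1 / u):] (pcompose f [:0, 1 / u:])) x = poly (monom 1 d) x"
        using \<open>u \<noteq> 0\<close> by (simp add: poly_pcompose f c poly_monom power_divide power_mult_distrib field_simps)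
    qed
    hence "conjugate_over (max_abelian_extension K) (f, \<alpha>) (monom 1 d, u * \<alpha>)"
      unfolding conjugate_over_def Let_def prod.case
      using uE zE \<open>u \<noteq> 0\<close> by (intro bexI[of _ "1 / u"] bexI[of _ 0]) (simp_all add: mult.commute)
    thus ?thesis using c \<gamma> by blast
  qed (use c0[OF comm] in simp)
  have bwd: "comm_group (G_infty K f \<alpha>)"
    if c: "c = 0" and *: "\<alpha> = 0 \<or> (\<exists>\<gamma>. (\<gamma> = 0 \<or> root_of_unity \<gamma>) \<and>
      conjugate_over (max_abelian_extension K) (f, \<alpha>) (monom 1 d, \<gamma>))"
  proof (cases "\<alpha> = 0")
    case True
    have "x = 0" if "(poly f ^^ n) x = 0" for x n
      using that by (induction n) (auto simp: f c assms(7))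
    \<comment> \<open>The tree over 0 is just {0}, so the group acts trivially on the
      generators.\<close>
    hence "S \<subseteq> K" using True subfield_ambientD(6)[OF K] unfolding S_iff subset_iff by metis
    hence fixS: "\<sigma> x = x" if "\<sigma> \<in> carrier (Gal L K)" "x \<in> S" for \<sigma> x
      using that by (auto simp: Gal_carrier_iff[OF sub])
    show ?thesis unfolding G L_def
      by (rule Gal_commI, fold L_def) (simp add: fixS)
  next
    case False
    then obtain \<gamma> w v where \<gamma>: "\<gamma> = 0 \<or> root_of_unity \<gamma>" and w: "w \<noteq> 0"
      and conj: "pcompose [:- v / w, 1 / w:] (pcompose f [:v, w:]) = monom 1 d"
      and "poly [:- v / w, 1 / w:] \<alpha> = \<gamma>"
      using * by (auto simp: conjugate_over_def Let_def)
    hence \<alpha>: "\<alpha> = w * \<gamma> + v" by (simp add: field_simps)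
    have fm: "a * (v + w * x) ^ d = w * x ^ d + v" for x
    proof -
      have "poly (pcompose [:- v / w, 1 / w:] (pcompose f [:v, w:])) x = x ^ d"
        unfolding conj by (simp add: poly_monom)
      hence "(a * (v + w * x) ^ d - v) / w = x ^ d"
        by (simp add: poly_pcompose f c diff_divide_distrib mult.commute)
      thus ?thesis using w by (simp add: divide_eq_eq diff_eq_eq mult.commute)
    qed
    hence "smult a ([:v, w:] ^ d) = monom w d + [:v:]"
      by (subst poly_eq_poly_eq_iff[symmetric], intro ext) (simp add: poly_monom mult.commute)
    \<comment> \<open>As d \<ge> 2, the right-hand side has no linear term, while on the left it is
      a d w v^(d-1); hence v = 0 in characteristic zero.\<close>
    from arg_cong[OF this, of "\<lambda>p. coeff p 1"] have "a * (of_nat d * w * v ^ (d - 1)) = 0"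
      using d by (simp add: coeff_linear_poly_power)
    hence v: "v = 0" using assms(7) w d by simp
    have \<gamma>': "root_of_unity \<gamma>" using \<gamma> \<alpha> v False by auto
    then obtain N where N: "N \<ge> 1" "\<gamma> ^ N = 1" by (auto simp: root_of_unity_def)
    \<comment> \<open>By f(w y) = w y^d, a tree point is w y with y^(d^n) = \<gamma>; dividing by
      \<alpha> = w \<gamma> cancels w and leaves a root of unity.\<close>
    have rho: "root_of_unity (x / \<alpha>)" if "x \<in> S" for x
    proof -
      obtain n where n: "(poly f ^^ n) x = \<alpha>" using \<open>x \<in> S\<close> by (auto simp: S_iff)
      have fw: "poly f (w * y) = w * y ^ d" for y using fm[of y] v by (simp add: f c)
      have fwn: "(poly f ^^ n) (w * y) = w * y ^ (d ^ n)" for y n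
        by (induction n) (simp_all add: fw mult.commute[of d] flip: power_mult)
      define y where "y = x / w"
      have "w * y = x" using w by (simp add: y_def)
      hence y: "y ^ (d ^ n) = \<gamma>" using fwn[of n y] n w \<alpha> v by simp
      have "x / \<alpha> = y / \<gamma>" by (simp add: \<alpha> v y_def)
      hence "(x / \<alpha>) ^ (d ^ n * N) = (y ^ (d ^ n)) ^ N / (\<gamma> ^ N) ^ (d ^ n)"
        by (simp add: power_divide mult.commute flip: power_mult)
      hence "(x / \<alpha>) ^ (d ^ n * N) = 1" by (simp add: y N(2))
      moreover have "d ^ n * N \<ge> 1" using d N(1) by simp
      ultimately show ?thesis unfolding root_of_unity_def by blast
    qed
    show ?thesis unfolding G L_def
    proof (rule Gal_commI, fold L_def)
      fix \<sigma> \<tau> x assume st: "\<sigma> \<in> carrier (Gal L K)" "\<tau> \<in> carrier (Gal L K)" and x: "x \<in> S"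
      have aL: "\<alpha> \<in> L" using inL assms(6) by blast
      have xL: "x / \<alpha> \<in> L"
        unfolding divide_inverse using inL x aL by (intro subfield_ambientD[OF sub]) auto
      have mult: "\<rho> (\<alpha> * y) = \<alpha> * \<rho> y" "\<rho> y \<in> L" if "\<rho> \<in> carrier (Gal L K)" "y \<in> L" for \<rho> y
        using that aL assms(6) bij_betwE[of \<rho> L L] by (auto simp: Gal_carrier_iff[OF sub])
      \<comment> \<open>Both \<sigma> and \<tau> fix the factor \<alpha>, so commutation at x
        reduces to the root of unity x / \<alpha>.\<close>
      define r where "r = x / \<alpha>"
      have "\<sigma> (\<tau> (\<alpha> * r)) = \<tau> (\<sigma> (\<alpha> * r))"
        using Gal_comm_root_of_unity[OF alg sub st xL rho[OF x]] mult[OF st(1)] mult[OF st(2)] xL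
        by (simp flip: r_def)
      thus "\<sigma> (\<tau> x) = \<tau> (\<sigma> x)" using False by (simp add: r_def)
    qed
  qed
  have "root_of_unity \<alpha>" if a1: "a = 1" and comm: "comm_group (G_infty K f \<alpha>)" and nz: "\<alpha> \<noteq> 0"
  proof -
    obtain n where n: "n \<ge> 1" "(u * \<alpha>) ^ n = 1"
      using rou[OF comm nz] by (auto simp: root_of_unity_def)
    \<comment> \<open>For a = 1 the scalar u is itself a (d-1)-st root of unity, so the power d - 1
      removes it.\<close>
    have "((u * \<alpha>) ^ n) ^ (d - 1) = (u ^ (d - 1)) ^ n * \<alpha> ^ (n * (d - 1))"
      by (simp add: power_mult_distrib mult.commute flip: power_mult)
    hence "\<alpha> ^ (n * (d - 1)) = 1" unfolding u a1 n(2) by simp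
    thus ?thesis using n(1) d unfolding root_of_unity_def by (intro exI[of _ "n * (d - 1)"]) simp
  qed
  thus ?thesis using fwd bwd c0 by blast
qed

end
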